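(* Let $T\in cv(F)$ and $\mu\in Curr(F)$, $\mu\ne 0$. Then \[ h_T(\mu)\le \rho(T,\mu). \]
   Context: $F$ is a free group of finite rank $k\ge 2$. $cv(F)$ is the set of all minimal, free and discrete isometric actions of $F$ on $\mathbb R$-trees $T$, two trees being equal if there is an $F$-equivariant isometry between them. Every $T\in cv(F)$ arises from an (essentially unique) marked metric graph structure: a finite connected graph $\Gamma=T/F$ without degree-one and degree-two vertices, an isomorphism $\alpha:F\to\pi_1(\Gamma,p)$, and a function $\mathcal L$ assigning to each oriented edge $e$ a length $\mathcal L(e)=\mathcal L(e^{-1})>0$, so that $T$ is the universal cover of $\Gamma$ with lifted edge-lengths and with $F$ acting via $\alpha$. For an edge-path $v=e_1,\dots,e_n$ in $\Gamma$, $\mathcal L(v)=\sum_i\mathcal L(e_i)$. $\partial F$ is the hyperbolic boundary of $F$ and $\partial^2F$ the set of pairs of distinct points of $\partial F$, with the translation action of $F$. $\partial T$ and $\partial^2 T$ denote the hyperbolic boundary of $T$ and the set of pairs of distinct points of it. Orbit maps $F\to T$ induce canonical $F$-equivariant homeomorphisms $\partial F\to\partial T$, $\partial^2F\to\partial^2T$, by which these are identified. A geodesic current on $F$ is a positive $F$-invariant Borel measure on $\partial^2F$ that is finite on compact subsets; $Curr(F)$ is the space of all geodesic currents. For $x\neq y$ in $T$, $[x,y]$ is the oriented geodesic segment from $x$ to $y$ and $Cyl_{[x,y]}\subseteq\partial^2F$ is the set of all $(\zeta_1,\zeta_2)$ such that the oriented bi-infinite geodesic in $T$ from $\zeta_1$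 to $\zeta_2$ contains $[x,y]$ with agreeing orientation. The geometric entropy of $\mu$ with respect to $T$ is \[ h_T(\mu):=\liminf_{d_T(x,y)\to\infty,\ x,y\in T}\frac{-\log\mu(Cyl_{[x,y]})}{d_T(x,y)},\qquad \log 0:=-\infty. \] For a nontrivial finite reduced (no backtracking) edge-path $v$ in $\Gamma$, $\langle v,\mu\rangle_\alpha:=\mu(Cyl_{\gamma})$, where $\gamma$ is any lift of $v$ to $T$ (well defined by $F$-invariance). Let $supp_\alpha(\mu)$ be the set of all such $v$ with $\langle v,\mu\rangle_\alpha>0$, let $\beta(R)=\#\{v\in supp_\alpha(\mu):\mathcal L(v)\le R\}$, and define \[ \rho(T,\mu):=\liminf_{R\to\infty}\frac{\log\beta(R)}{R}. \] *)

theory Defs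
  imports "HOL-Analysis.Analysis" "HOL-Algebra.Group_Action"
begin

section \<open>Free groups and their word metrics\<close>

text \<open>Words are lists of letters; \<open>(True, x)\<close> stands for \<open>x\<close> and \<open>(False, x)\<close> for its inverse.\<close>

definition word_value :: "('g, 'b) monoid_scheme \<Rightarrow> (bool \<times> 'g) list \<Rightarrow> 'g" where
  "word_value G w =
     foldr (\<lambda>(b, x) a. (if b then x else inv\<^bsub>G\<^esub> x) \<otimes>\<^bsub>G\<^esub> a) w \<one>\<^bsub>G\<^esub>"

definition reduced_word :: "(bool \<times> 'g) list \<Rightarrow> bool" where
  "reduced_word w \<longleftrightarrow> successively (\<lambda>l m. m \<noteq> (\<not> fst l, snd l)) w"

definition free_basis :: "('g, 'b) monoid_scheme \<Rightarrow> 'g set \<Rightarrow> bool" where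
  "free_basis G X \<longleftrightarrow> group G \<and> X \<subseteq> carrier G \<and>
     (\<forall>g\<in>carrier G. \<exists>!w. w \<in> lists (UNIV \<times> X) \<and> reduced_word w \<and> word_value G w = g)"

definition word_length :: "('g, 'b) monoid_scheme \<Rightarrow> 'g set \<Rightarrow> 'g \<Rightarrow> nat" where
  "word_length G X g = (LEAST n. \<exists>w \<in> lists (UNIV \<times> X). length w = n \<and> word_value G w = g)"

definition word_dist :: "('g, 'b) monoid_scheme \<Rightarrow> 'g set \<Rightarrow> 'g \<Rightarrow> 'g \<Rightarrow> real" where
  "word_dist G X g h = real (word_length G X (inv\<^bsub>G\<^esub> g \<otimes>\<^bsub>G\<^esub> h))"

section \<open>The hyperbolic (Gromov) boundary\<close>

text \<open>
  \<open>S\<close> is the underlying set, \<open>d\<close> the distance and \<open>p\<close> a base point. A boundary point is a class of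
  sequences in \<open>S\<close> converging to infinity. For a metric \<open>d\<close>, changing \<open>p\<close> changes Gromov products
  by a bounded amount only, so neither the boundary nor its topology depends on \<open>p\<close>.
\<close>

definition gromov_product :: "('a \<Rightarrow> 'a \<Rightarrow> real) \<Rightarrow> 'a \<Rightarrow> 'a \<Rightarrow> 'a \<Rightarrow> real" where
  "gromov_product d p x y = (d p x + d p y - d x y) / 2"

definition gromov_seq :: "'a set \<Rightarrow> ('a \<Rightarrow> 'a \<Rightarrow> real) \<Rightarrow> 'a \<Rightarrow> (nat \<Rightarrow> 'a) \<Rightarrow> bool" where
  "gromov_seq S d p x \<longleftrightarrow> range x \<subseteq> S \<and>
     filterlim (\<lambda>(i, j). gromov_product d p (x i) (x j)) at_top (sequentially \<times>\<^sub>F sequentially)"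

definition gromov_equiv ::
  "'a set \<Rightarrow> ('a \<Rightarrow> 'a \<Rightarrow> real) \<Rightarrow> 'a \<Rightarrow> (nat \<Rightarrow> 'a) \<Rightarrow> (nat \<Rightarrow> 'a) \<Rightarrow> bool" where
  "gromov_equiv S d p x y \<longleftrightarrow> gromov_seq S d p x \<and> gromov_seq S d p y \<and>
     filterlim (\<lambda>(i, j). gromov_product d p (x i) (y j)) at_top (sequentially \<times>\<^sub>F sequentially)"

definition gromov_boundary :: "'a set \<Rightarrow> ('a \<Rightarrow> 'a \<Rightarrow> real) \<Rightarrow> 'a \<Rightarrow> (nat \<Rightarrow> 'a) set set" where
  "gromov_boundary S d p =
     {x. gromov_seq S d p x} // {(x, y). gromov_equiv S d p x y}"

definition gromov_nbhd ::
  "'a set \<Rightarrow> ('a \<Rightarrow> 'a \<Rightarrow> real) \<Rightarrow> 'a \<Rightarrow> (nat \<Rightarrow> 'a) set \<Rightarrow> real \<Rightarrow> (nat \<Rightarrow> 'a) set set" where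
  "gromov_nbhd S d p \<xi> r = {\<eta> \<in> gromov_boundary S d p. \<exists>x\<in>\<xi>. \<exists>y\<in>\<eta>.
     \<forall>\<^sub>F (i, j) in sequentially \<times>\<^sub>F sequentially. r \<le> gromov_product d p (x i) (y j)}"

definition gromov_topology ::
  "'a set \<Rightarrow> ('a \<Rightarrow> 'a \<Rightarrow> real) \<Rightarrow> 'a \<Rightarrow> (nat \<Rightarrow> 'a) set topology" where
  "gromov_topology S d p = topology (\<lambda>A. A \<subseteq> gromov_boundary S d p \<and>
     (\<forall>\<xi>\<in>A. \<exists>r. gromov_nbhd S d p \<xi> r \<subseteq> A))"

lemma gromov_nbhd_antimono: "r \<le> r' \<Longrightarrow> gromov_nbhd S d p \<xi> r' \<subseteq> gromov_nbhd S d p \<xi> r"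
proof
  fix \<eta> assume le: "r \<le> r'" and "\<eta> \<in> gromov_nbhd S d p \<xi> r'"
  then obtain x y where *: "\<eta> \<in> gromov_boundary S d p" "x \<in> \<xi>" "y \<in> \<eta>"
      "\<forall>\<^sub>F (i, j) in sequentially \<times>\<^sub>F sequentially. r' \<le> gromov_product d p (x i) (y j)"
    unfolding gromov_nbhd_def by blast
  from *(4) have "\<forall>\<^sub>F (i, j) in sequentially \<times>\<^sub>F sequentially.
      r \<le> gromov_product d p (x i) (y j)"
    by (rule eventually_mono) (use le in auto)
  with *(1-3) show "\<eta> \<in> gromov_nbhd S d p \<xi> r"
    unfolding gromov_nbhd_def by blast
qed

lemma openin_gromov_topology:
  "openin (gromov_topology S d p) A \<longleftrightarrow>
     A \<subseteq> gromov_boundary S d p \<and> (\<forall>\<xi>\<in>A. \<exists>r. gromov_nbhd S d p \<xi> r \<subseteq> A)"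
proof -
  have "istopology (\<lambda>A. A \<subseteq> gromov_boundary S d p \<and> (\<forall>\<xi>\<in>A. \<exists>r. gromov_nbhd S d p \<xi> r \<subseteq> A))"
    unfolding istopology_def
  proof (intro conjI allI impI ballI)
    fix A B \<xi>
    assume A: "A \<subseteq> gromov_boundary S d p \<and> (\<forall>\<xi>\<in>A. \<exists>r. gromov_nbhd S d p \<xi> r \<subseteq> A)"
      and B: "B \<subseteq> gromov_boundary S d p \<and> (\<forall>\<xi>\<in>B. \<exists>r. gromov_nbhd S d p \<xi> r \<subseteq> B)"
      and \<xi>: "\<xi> \<in> A \<inter> B"
    then obtain r s where "gromov_nbhd S d p \<xi> r \<subseteq> A" "gromov_nbhd S d p \<xi> s \<subseteq> B"
      by blast
    then have "gromov_nbhd S d p \<xi> (max r s) \<subseteq> A \<inter> B"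
      using gromov_nbhd_antimono[of r "max r s" S d p \<xi>]
        gromov_nbhd_antimono[of s "max r s" S d p \<xi>] by auto
    then show "\<exists>r. gromov_nbhd S d p \<xi> r \<subseteq> A \<inter> B" ..
  next
    fix \<K> \<xi>
    assume K: "\<forall>A\<in>\<K>. A \<subseteq> gromov_boundary S d p \<and> (\<forall>\<xi>\<in>A. \<exists>r. gromov_nbhd S d p \<xi> r \<subseteq> A)"
      and "\<xi> \<in> \<Union>\<K>"
    then obtain A r where "A \<in> \<K>" "gromov_nbhd S d p \<xi> r \<subseteq> A"
      by blast
    then show "\<exists>r. gromov_nbhd S d p \<xi> r \<subseteq> \<Union>\<K>"
      by blast
  qed auto
  then show ?thesis
    by (simp add: gromov_topology_def)
qed

section \<open>Geodesic currents\<close>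

definition free_boundary :: "('g, 'b) monoid_scheme \<Rightarrow> 'g set \<Rightarrow> (nat \<Rightarrow> 'g) set topology" where
  "free_boundary G X = gromov_topology (carrier G) (word_dist G X) \<one>\<^bsub>G\<^esub>"

definition free_boundary2 ::
  "('g, 'b) monoid_scheme \<Rightarrow> 'g set \<Rightarrow> ((nat \<Rightarrow> 'g) set \<times> (nat \<Rightarrow> 'g) set) topology" where
  "free_boundary2 G X =
     subtopology (prod_topology (free_boundary G X) (free_boundary G X)) {(\<zeta>1, \<zeta>2). \<zeta>1 \<noteq> \<zeta>2}"

definition boundary_translate ::
  "('g, 'b) monoid_scheme \<Rightarrow> 'g \<Rightarrow> (nat \<Rightarrow> 'g) set \<Rightarrow> (nat \<Rightarrow> 'g) set" where
  "boundary_translate G g \<zeta> = (\<lambda>x n. g \<otimes>\<^bsub>G\<^esub> x n) ` \<zeta>"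

definition Curr ::
  "('g, 'b) monoid_scheme \<Rightarrow> 'g set \<Rightarrow> ((nat \<Rightarrow> 'g) set \<times> (nat \<Rightarrow> 'g) set) measure set" where
  "Curr G X = {\<mu>.
     space \<mu> = topspace (free_boundary2 G X) \<and>
     sets \<mu> = sigma_sets (topspace (free_boundary2 G X)) {U. openin (free_boundary2 G X) U} \<and>
     (\<forall>g\<in>carrier G. \<forall>A\<in>sets \<mu>.
        emeasure \<mu> (map_prod (boundary_translate G g) (boundary_translate G g) ` A) =
        emeasure \<mu> A) \<and>
     (\<forall>K. compactin (free_boundary2 G X) K \<longrightarrow> emeasure \<mu> K < \<infinity>)}"

section \<open>\<open>\<real>\<close>-trees\<close>

definition (in metric_space) geodesic_segment :: "'a set \<Rightarrow> 'a \<Rightarrow> 'a \<Rightarrow> bool" where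
  "geodesic_segment S x y \<longleftrightarrow> (\<exists>c :: real \<Rightarrow> 'a.
     c 0 = x \<and> c (dist x y) = y \<and> S = c ` {0..dist x y} \<and>
     (\<forall>s\<in>{0..dist x y}. \<forall>t\<in>{0..dist x y}. dist (c s) (c t) = \<bar>s - t\<bar>))"

class real_tree = metric_space +
  assumes ex1_geodesic_segment: "\<exists>!S. geodesic_segment S x y"
    and geodesic_segment_Un:
      "geodesic_segment A y x \<Longrightarrow> geodesic_segment B x z \<Longrightarrow> A \<inter> B = {x} \<Longrightarrow>
       geodesic_segment (A \<union> B) y z"

definition seg :: "'t::real_tree \<Rightarrow> 't \<Rightarrow> 't set" where
  "seg x y = (THE S. geodesic_segment S x y)"

definition subtree :: "'t::real_tree set \<Rightarrow> bool" where
  "subtree S \<longleftrightarrow> S \<noteq> {} \<and> (\<forall>x\<in>S. \<forall>y\<in>S. seg x y \<subseteq> S)"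

text \<open>
  The tree is the type \<open>'t\<close>; \<open>cv G act\<close> says that \<open>'t\<close> with the action \<open>act\<close> is a point of the
  unprojectivised outer space of \<open>G\<close>. Discreteness of the action means discreteness of all orbits.
\<close>

definition cv :: "('g, 'b) monoid_scheme \<Rightarrow> ('g \<Rightarrow> 't::real_tree \<Rightarrow> 't) \<Rightarrow> bool" where
  "cv G act \<longleftrightarrow> group_action G UNIV act \<and>
     (\<forall>g\<in>carrier G. \<forall>x y. dist (act g x) (act g y) = dist x y) \<and>
     (\<forall>g\<in>carrier G. \<forall>x. act g x = x \<longrightarrow> g = \<one>\<^bsub>G\<^esub>) \<and>
     (\<forall>x. discrete (orbit G act x)) \<and>
     (\<forall>S. subtree S \<and> (\<forall>g\<in>carrier G. act g ` S \<subseteq> S) \<longrightarrow> S = UNIV)"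

section \<open>Cylinders and geometric entropy\<close>

text \<open>
  The canonical map from the boundary of the group to that of the tree. All orbit maps
  \<open>\<lambda>g. act g p\<close> induce the same map, so the union over \<open>p\<close> is a single class.
\<close>

definition orbit_boundary_map ::
  "('g \<Rightarrow> 't::real_tree \<Rightarrow> 't) \<Rightarrow> (nat \<Rightarrow> 'g) set \<Rightarrow> (nat \<Rightarrow> 't) set" where
  "orbit_boundary_map act \<zeta> = {y. \<exists>p. \<exists>x\<in>\<zeta>. gromov_equiv UNIV dist p (\<lambda>n. act (x n) p) y}"

definition geodesic_line :: "(real \<Rightarrow> 't::real_tree) \<Rightarrow> bool" where
  "geodesic_line c \<longleftrightarrow> (\<forall>s t. dist (c s) (c t) = \<bar>s - t\<bar>)"

text \<open>
  A geodesic line with \<open>c s = x\<close> and \<open>c t = y\<close> for some \<open>s < t\<close> runs through the segment from \<open>x\<close>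
  to \<open>y\<close> in this direction, since that segment is unique. The definition is meant for \<open>x \<noteq> y\<close>.
\<close>

definition Cyl ::
  "('g, 'b) monoid_scheme \<Rightarrow> 'g set \<Rightarrow> ('g \<Rightarrow> 't::real_tree \<Rightarrow> 't) \<Rightarrow> 't \<Rightarrow> 't \<Rightarrow>
   ((nat \<Rightarrow> 'g) set \<times> (nat \<Rightarrow> 'g) set) set" where
  "Cyl G X act x y = {(\<zeta>1, \<zeta>2) \<in> topspace (free_boundary2 G X).
     \<exists>c. geodesic_line c \<and>
         (\<lambda>n. c (- real n)) \<in> orbit_boundary_map act \<zeta>1 \<and>
         (\<lambda>n. c (real n)) \<in> orbit_boundary_map act \<zeta>2 \<and>
         (\<exists>s t. s < t \<and> c s = x \<and> c t = y)}"

definition elog :: "ennreal \<Rightarrow> ereal" where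
  "elog a = (if a = 0 then -\<infinity> else if a = \<infinity> then \<infinity> else ereal (ln (enn2real a)))"

definition geometric_entropy ::
  "('g, 'b) monoid_scheme \<Rightarrow> 'g set \<Rightarrow> ('g \<Rightarrow> 't::real_tree \<Rightarrow> 't) \<Rightarrow>
   ((nat \<Rightarrow> 'g) set \<times> (nat \<Rightarrow> 'g) set) measure \<Rightarrow> ereal" where
  "geometric_entropy G X act \<mu> =
     Liminf (filtercomap (\<lambda>(x, y). dist x y) at_top)
       (\<lambda>(x, y). - elog (emeasure \<mu> (Cyl G X act x y)) / ereal (dist x y))"

section \<open>The quotient graph and the growth of the support\<close>

text \<open>
  The graph structure without vertices of degree one or two on the tree: its vertices are the points
  with at least three directions (a minimal tree has no endpoints). An oriented edge of the tree is
  given by its initial and its terminal vertex.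
\<close>

definition tree_vertex :: "'t::real_tree \<Rightarrow> bool" where
  "tree_vertex x \<longleftrightarrow> (\<exists>a b c. a \<noteq> x \<and> b \<noteq> x \<and> c \<noteq> x \<and>
     x \<in> seg a b \<and> x \<in> seg b c \<and> x \<in> seg a c)"

definition tree_edges :: "('t::real_tree \<times> 't) set" where
  "tree_edges = {(x, y). x \<noteq> y \<and> tree_vertex x \<and> tree_vertex y \<and>
     (\<forall>z\<in>seg x y. tree_vertex z \<longrightarrow> z = x \<or> z = y)}"

text \<open>
  The quotient graph has as vertices the orbits of vertices and as oriented edges the orbits of
  oriented edges of the tree. An orbit \<open>e\<close> of edges is a set of pairs of points, its initial vertex
  is the orbit \<open>fst ` e\<close>, its terminal vertex is \<open>snd ` e\<close>, and the reversed edge is the converse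
  relation \<open>e\<inverse>\<close>. The marking is the identification of \<open>G\<close> with the deck group of the tree.
\<close>

definition edge_orbit ::
  "('g, 'b) monoid_scheme \<Rightarrow> ('g \<Rightarrow> 't::real_tree \<Rightarrow> 't) \<Rightarrow> 't \<times> 't \<Rightarrow> ('t \<times> 't) set" where
  "edge_orbit G act e = orbit G (\<lambda>g. map_prod (act g) (act g)) e"

definition graph_edges ::
  "('g, 'b) monoid_scheme \<Rightarrow> ('g \<Rightarrow> 't::real_tree \<Rightarrow> 't) \<Rightarrow> ('t \<times> 't) set set" where
  "graph_edges G act = edge_orbit G act ` tree_edges"

definition edge_length :: "('t::real_tree \<times> 't) set \<Rightarrow> real" where
  "edge_length e = (THE l. \<forall>(x, y)\<in>e. dist x y = l)"

definition path_length :: "('t::real_tree \<times> 't) set list \<Rightarrow> real" where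
  "path_length v = sum_list (map edge_length v)"

definition reduced_paths ::
  "('g, 'b) monoid_scheme \<Rightarrow> ('g \<Rightarrow> 't::real_tree \<Rightarrow> 't) \<Rightarrow> ('t \<times> 't) set list set" where
  "reduced_paths G act = {v. v \<noteq> [] \<and> set v \<subseteq> graph_edges G act \<and>
     successively (\<lambda>e e'. snd ` e = fst ` e' \<and> e' \<noteq> e\<inverse>) v}"

definition is_lift ::
  "('g, 'b) monoid_scheme \<Rightarrow> ('g \<Rightarrow> 't::real_tree \<Rightarrow> 't) \<Rightarrow>
   ('t \<times> 't) set list \<Rightarrow> ('t \<times> 't) list \<Rightarrow> bool" where
  "is_lift G act v \<gamma> \<longleftrightarrow> set \<gamma> \<subseteq> tree_edges \<and>
     successively (\<lambda>e e'. snd e = fst e') \<gamma> \<and> map (edge_orbit G act) \<gamma> = v"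

definition path_measure ::
  "('g, 'b) monoid_scheme \<Rightarrow> 'g set \<Rightarrow> ('g \<Rightarrow> 't::real_tree \<Rightarrow> 't) \<Rightarrow>
   ((nat \<Rightarrow> 'g) set \<times> (nat \<Rightarrow> 'g) set) measure \<Rightarrow> ('t \<times> 't) set list \<Rightarrow> ennreal" where
  "path_measure G X act \<mu> v =
     (let \<gamma> = (SOME \<gamma>. is_lift G act v \<gamma>)
      in emeasure \<mu> (Cyl G X act (fst (hd \<gamma>)) (snd (last \<gamma>))))"

definition supp ::
  "('g, 'b) monoid_scheme \<Rightarrow> 'g set \<Rightarrow> ('g \<Rightarrow> 't::real_tree \<Rightarrow> 't) \<Rightarrow>
   ((nat \<Rightarrow> 'g) set \<times> (nat \<Rightarrow> 'g) set) measure \<Rightarrow> ('t \<times> 't) set list set" where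
  "supp G X act \<mu> = {v \<in> reduced_paths G act. path_measure G X act \<mu> v > 0}"

text \<open>Cardinality is taken in \<open>[0, \<infinity>]\<close>, so that no finiteness is built into the definition.\<close>

definition supp_count ::
  "('g, 'b) monoid_scheme \<Rightarrow> 'g set \<Rightarrow> ('g \<Rightarrow> 't::real_tree \<Rightarrow> 't) \<Rightarrow>
   ((nat \<Rightarrow> 'g) set \<times> (nat \<Rightarrow> 'g) set) measure \<Rightarrow> real \<Rightarrow> ennreal" where
  "supp_count G X act \<mu> R =
     emeasure (count_space UNIV) {v \<in> supp G X act \<mu>. path_length v \<le> R}"

definition supp_growth ::
  "('g, 'b) monoid_scheme \<Rightarrow> 'g set \<Rightarrow> ('g \<Rightarrow> 't::real_tree \<Rightarrow> 't) \<Rightarrow>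
   ((nat \<Rightarrow> 'g) set \<times> (nat \<Rightarrow> 'g) set) measure \<Rightarrow> ereal" where
  "supp_growth G X act \<mu> = Liminf at_top (\<lambda>R. elog (supp_count G X act \<mu> R) / ereal R)"

end

theory Submission
  imports Defs
begin

text \<open>
  Fix two points \<open>x \<noteq> y\<close> whose cylinder has mass \<open>m > 0\<close>, with \<open>x\<close> a vertex. A geodesic line through \<open>x\<close>
  and \<open>y\<close> passes a vertex in every window of length \<open>2 * D\<close>, so for each \<open>R > 0\<close> the cylinder of \<open>x\<close>,
  \<open>y\<close> is covered by the cylinders of the pairs \<open>x\<close>, \<open>z\<close>, where \<open>z\<close> runs through the vertices with
  \<open>R \<le> dist x z \<le> R + 2 * D\<close>. If \<open>h\<close> is below the geometric entropy, each of these has mass at most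
  about \<open>exp (- h * R)\<close>, so at least \<open>m * exp (h * R)\<close> of them, up to a constant factor, have positive mass. Each such
  \<open>z\<close> gives the reduced edge path in the quotient that lifts to \<open>seg x z\<close>, and different \<open>z\<close> give
  different paths. Hence \<open>supp_count\<close> grows at rate at least \<open>h\<close>. This is
  \<open>emeasure_Cyl_le_supp_count\<close> and \<open>le_supp_growth\<close>.

  For the count to make sense, three things have to be known about the tree and the action.

  The tree is a metric graph with compact quotient. The action is cocompact by minimality
  (\<open>cover_by_segments\<close>), orbit points in a ball are finite in number by discreteness and freeness
  (\<open>finite_orbit_ball\<close>), branch points exist because a free group of rank at least two does not act freely on
  an interval (\<open>ex_vertex\<close>), and segments contain finitely many of them (\<open>finite_vertices_seg\<close>).

  The boundary of the group is the space of ends of the tree, and cylinders are open, hence measurable.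
  Both the word metric and the tree have Gromov products that satisfy the ultrametric inequality
  \<open>(x|z) \<ge> min (x|y) (y|z)\<close>. Large Gromov products in one of the two spaces are therefore carried to the
  other one along a path of bounded steps that avoids a large ball
  (\<open>tprod_large_of_wprod_large\<close>, \<open>wprod_large_of_tprod_large\<close>). Among the pairs of distinct
  points a cylinder is the product of two shadows, and shadows are open (\<open>Cyl_iff_shadow\<close>, \<open>openin_shadow\<close>).

  The mass of the cylinder of a lift depends on the path only: cylinders are equivariant and two lifts of
  a path are translates of each other (\<open>Cyl_act\<close>, \<open>lift_unique_up_to_translation\<close>).
\<close>

section \<open>Geometry of real trees\<close>

lemma geodesic_segment_seg: "geodesic_segment (seg x y) x y"
  unfolding seg_def by (rule theI'[OF ex1_geodesic_segment])

lemma seg_unique: "geodesic_segment S x y \<Longrightarrow> S = seg x y"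
  using ex1_geodesic_segment geodesic_segment_seg by blast

lemma seg_param:
  obtains c :: "real \<Rightarrow> 't::real_tree" where "c 0 = x" "c (dist x y) = y" "seg x y = c ` {0..dist x y}"
    "\<And>s t. s \<in> {0..dist x y} \<Longrightarrow> t \<in> {0..dist x y} \<Longrightarrow> dist (c s) (c t) = \<bar>s - t\<bar>"
  using geodesic_segment_seg[of x y] unfolding geodesic_segment_def by blast

text \<open>Two geodesics whose lengths add up to the distance of the endpoints form a geodesic: the triangle inequality
  through the common point gives one bound, the one between the endpoints the other.\<close>

lemma dist_add_concat:
  fixes x y z :: "'t::real_tree"
  assumes z: "dist x z + dist z y = dist x y"
  shows "geodesic_segment (seg x z \<union> seg z y) x y"
proof -
  obtain c1 where c1: "c1 0 = x" "c1 (dist x z) = z" "seg x z = c1 ` {0..dist x z}"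
    "\<And>s t. s \<in> {0..dist x z} \<Longrightarrow> t \<in> {0..dist x z} \<Longrightarrow> dist (c1 s) (c1 t) = \<bar>s - t\<bar>"
    by (rule seg_param[of x z]) blast
  obtain c2 where c2: "c2 0 = z" "c2 (dist z y) = y" "seg z y = c2 ` {0..dist z y}"
    "\<And>s t. s \<in> {0..dist z y} \<Longrightarrow> t \<in> {0..dist z y} \<Longrightarrow> dist (c2 s) (c2 t) = \<bar>s - t\<bar>"
    by (rule seg_param[of z y]) blast
  define D where "D = dist x z"
  define c where "c t = (if t \<le> D then c1 t else c2 (t - D))" for t
  have D: "0 \<le> D" "dist x y = D + dist z y" using z by (auto simp: D_def)
  have pre: "dist (c s) (c t) = \<bar>s - t\<bar>"
    if st: "0 \<le> s" "s \<le> t" "t \<le> dist x y" for s t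
  proof -
    consider "t \<le> D" | "D < s" | "s \<le> D" "D < t" by linarith
    then show ?thesis
    proof cases
      case 1 then show ?thesis using st c1(4)[of s t] by (auto simp: c_def D_def)
    next
      case 2 then show ?thesis using st D c2(4)[of "s - D" "t - D"] by (auto simp: c_def)
    next
      case 3
      have e1: "dist (c1 s) z = D - s" "dist x (c1 s) = s"
        using c1(4)[of s D] c1(4)[of 0 s] 3 st c1(1,2) by (auto simp: D_def)
      have e2: "dist z (c2 (t - D)) = t - D" "dist (c2 (t - D)) y = dist x y - t"
        using c2(4)[of 0 "t - D"] c2(4)[of "t-D" "dist z y"] 3 st D c2(1,2) by auto
      have "dist x y \<le> dist x (c1 s) + dist (c1 s) (c2 (t-D)) + dist (c2 (t-D)) y"
        using dist_triangle[of x y "c1 s"] dist_triangle[of "c1 s" y "c2 (t-D)"] by linarith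
      moreover have "dist (c1 s) (c2 (t-D)) \<le> dist (c1 s) z + dist z (c2 (t-D))"
        by (rule dist_triangle)
      ultimately show ?thesis using 3 e1 e2 by (simp add: c_def)
    qed
  qed
  have iso: "dist (c s) (c t) = \<bar>s - t\<bar>" if "s \<in> {0..dist x y}" "t \<in> {0..dist x y}" for s t
    using pre[of s t] pre[of t s] that by (cases "s \<le> t") (auto simp: dist_commute)
  have c0: "c 0 = x" using D c1(1) by (simp add: c_def)
  have c1': "c (dist x y) = y"
  proof (cases "dist z y = 0")
    case True
    then have "dist x y = D" "z = y" using D(2) by auto
    then show ?thesis using c1(2) by (simp add: c_def D_def)
  next
    case False
    then have "\<not> dist x y \<le> D" "dist x y - D = dist z y" using D(2) by auto
    then show ?thesis using c2(2) by (simp add: c_def)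
  qed
  have "c ` {0..dist x y} = seg x z \<union> seg z y"
  proof (intro equalityI subsetI)
    fix u assume "u \<in> c ` {0..dist x y}"
    then obtain t where t: "0 \<le> t" "t \<le> dist x y" "u = c t" by auto
    show "u \<in> seg x z \<union> seg z y"
      using t D by (cases "t \<le> D") (auto simp: c_def c1(3) c2(3) D_def)
  next
    fix u assume "u \<in> seg x z \<union> seg z y"
    then show "u \<in> c ` {0..dist x y}"
    proof
      assume "u \<in> seg x z"
      then obtain t where "0 \<le> t" "t \<le> D" "u = c1 t" by (auto simp: c1(3) D_def)
      then show ?thesis using D by (intro image_eqI[of _ _ t]) (auto simp: c_def intro: order_trans)
    next
      assume "u \<in> seg z y"
      then obtain t where t: "0 \<le> t" "t \<le> dist z y" "u = c2 t" by (auto simp: c2(3))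
      show ?thesis
      proof (cases "t = 0")
        case True
        then have "u = c D" using t c1(2) c2(1) by (simp add: c_def D_def)
        then show ?thesis using D by (intro image_eqI[of _ _ D]) auto
      next
        case False
        then show ?thesis using D t by (intro image_eqI[of _ _ "t + D"]) (auto simp: c_def)
      qed
    qed
  qed
  then show ?thesis
    unfolding geodesic_segment_def using c0 c1' iso by metis
qed

lemma mem_seg_endpoints: "x \<in> seg x y" "y \<in> seg x y"
proof -
  obtain c where c: "c 0 = x" "c (dist x y) = y" "seg x y = c ` {0..dist x y}"
    by (rule seg_param[of x y]) blast
  show "x \<in> seg x y" using c by (force intro: image_eqI[of _ _ 0])
  show "y \<in> seg x y" using c by (force intro: image_eqI[of _ _ "dist x y"])
qed

text \<open>Segments are metric intervals. From here on, statements about segments are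
  linear arithmetic on distances.\<close>

lemma mem_seg_iff: "z \<in> seg x y \<longleftrightarrow> dist x z + dist z y = dist x y"
proof
  assume "z \<in> seg x y"
  obtain c where c: "c 0 = x" "c (dist x y) = y" "seg x y = c ` {0..dist x y}"
    "\<And>s t. s \<in> {0..dist x y} \<Longrightarrow> t \<in> {0..dist x y} \<Longrightarrow> dist (c s) (c t) = \<bar>s - t\<bar>"
    by (rule seg_param[of x y]) blast
  with \<open>z \<in> seg x y\<close> obtain t where t: "t \<in> {0..dist x y}" "z = c t" by auto
  then show "dist x z + dist z y = dist x y"
    using c(4)[of 0 t] c(4)[of t "dist x y"] c(1,2) by auto
next
  assume "dist x z + dist z y = dist x y"
  from seg_unique[OF dist_add_concat[OF this]] mem_seg_endpoints(2)[of z x]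
  show "z \<in> seg x y" by blast
qed

lemma seg_commute: "seg x y = seg y x"
  by (auto simp: mem_seg_iff dist_commute add.commute)

lemma seg_at_dist:
  fixes x y :: "'t::real_tree"
  assumes "0 \<le> t" "t \<le> dist x y"
  obtains z where "z \<in> seg x y" "dist x z = t"
proof -
  obtain c where c: "c 0 = x" "c (dist x y) = y" "seg x y = c ` {0..dist x y}"
    "\<And>s t. s \<in> {0..dist x y} \<Longrightarrow> t \<in> {0..dist x y} \<Longrightarrow> dist (c s) (c t) = \<bar>s - t\<bar>"
    by (rule seg_param[of x y]) blast
  have "dist x (c t) = t" using c(4)[of 0 t] c(1) assms by auto
  then show ?thesis using that[of "c t"] c(3) assms by auto
qed

lemma seg_linear:
  assumes "w \<in> seg p u" "v \<in> seg p u"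
  shows "dist w v = \<bar>dist p w - dist p v\<bar>"
proof -
  obtain c where c: "c 0 = p" "c (dist p u) = u" "seg p u = c ` {0..dist p u}"
    "\<And>s t. s \<in> {0..dist p u} \<Longrightarrow> t \<in> {0..dist p u} \<Longrightarrow> dist (c s) (c t) = \<bar>s - t\<bar>"
    by (rule seg_param[of p u]) blast
  from assms obtain s t where st: "s \<in> {0..dist p u}" "t \<in> {0..dist p u}" "w = c s" "v = c t"
    using c(3) by auto
  show ?thesis using c(4)[of 0 s] c(4)[of 0 t] c(4)[of s t] st c(1) by auto
qed

lemma compact_seg: "compact (seg x y)"
proof -
  obtain c where c: "seg x y = c ` {0..dist x y}"
    "\<And>s t. s \<in> {0..dist x y} \<Longrightarrow> t \<in> {0..dist x y} \<Longrightarrow> dist (c s) (c t) = \<bar>s - t\<bar>"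
    by (rule seg_param[of x y]) blast
  have "continuous_on {0..dist x y} c"
    unfolding continuous_on_iff by (metis c(2) dist_real_def dist_commute)
  then show ?thesis using c(1) compact_continuous_image by fastforce
qed

text \<open>The median is the point of \<open>seg x y \<inter> seg x z\<close> farthest from \<open>x\<close>: past it the two segments
  have separated, so the concatenation axiom puts it on \<open>seg y z\<close> as well.\<close>

lemma ex_median:
  fixes x y z :: "'t::real_tree"
  shows "\<exists>w. w \<in> seg x y \<and> w \<in> seg x z \<and> w \<in> seg y z"
proof -
  have "compact (seg x y \<inter> seg x z)" "seg x y \<inter> seg x z \<noteq> {}"
    using compact_seg mem_seg_endpoints(1)[of x] by (blast intro: compact_Int)+
  moreover have "continuous_on (seg x y \<inter> seg x z) (dist x)"
    by (intro continuous_intros)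
  ultimately obtain w where w: "w \<in> seg x y" "w \<in> seg x z"
    and mx: "\<And>u. u \<in> seg x y \<Longrightarrow> u \<in> seg x z \<Longrightarrow> dist x u \<le> dist x w"
    using continuous_attains_sup[of "seg x y \<inter> seg x z" "dist x"] by auto
  have "seg y w \<inter> seg w z = {w}"
  proof (intro equalityI subsetI)
    fix u assume "u \<in> seg y w \<inter> seg w z"
    then have u: "dist y u + dist u w = dist y w" "dist w u + dist u z = dist w z"
      by (auto simp: mem_seg_iff)
    have W: "dist x w + dist w y = dist x y" "dist x w + dist w z = dist x z"
      using w by (auto simp: mem_seg_iff)
    have tr: "dist x u \<le> dist x w + dist w u" "dist x y \<le> dist x u + dist u y"
       "dist x z \<le> dist x u + dist u z"
      by (auto intro: dist_triangle)
    have "u \<in> seg x y" "u \<in> seg x z" and D: "dist x u = dist x w + dist w u"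
      using u W tr by (auto simp: mem_seg_iff dist_commute)
    with mx[of u] show "u \<in> {w}" by simp
  qed (simp add: mem_seg_endpoints)
  then have "geodesic_segment (seg y w \<union> seg w z) y z"
    using geodesic_segment_Un[OF geodesic_segment_seg geodesic_segment_seg] by blast
  from seg_unique[OF this] have "w \<in> seg y z" using mem_seg_endpoints by blast
  with w show ?thesis by blast
qed

definition median :: "'t::real_tree \<Rightarrow> 't \<Rightarrow> 't \<Rightarrow> 't" where
  "median x y z = (SOME w. w \<in> seg x y \<and> w \<in> seg x z \<and> w \<in> seg y z)"

lemma median_in: "median x y z \<in> seg x y" "median x y z \<in> seg x z" "median x y z \<in> seg y z"
  using someI_ex[OF ex_median[of x y z]] by (auto simp: median_def)

lemma median_dist: "w \<in> seg x y \<Longrightarrow> w \<in> seg x z \<Longrightarrow> w \<in> seg y z \<Longrightarrow>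
    dist x w = gromov_product dist x y z"
  by (auto simp: mem_seg_iff gromov_product_def dist_commute)

lemma median_unique:
  assumes "w \<in> seg x y" "w \<in> seg x z" "w \<in> seg y z"
  shows "w = median x y z"
  using seg_linear[OF assms(1) median_in(1)[of x y z]] median_dist[OF assms]
    median_dist[OF median_in, of x y z] by simp

section \<open>Gromov products in a tree\<close>

abbreviation tprod :: "'t::real_tree \<Rightarrow> 't \<Rightarrow> 't \<Rightarrow> real" where
  "tprod \<equiv> gromov_product dist"

lemma tprod_commute: "tprod p x y = tprod p y x"
  by (simp add: gromov_product_def dist_commute)

lemma tprod_nonneg: "0 \<le> tprod p x y"
  using dist_triangle3[of x y p] by (simp add: gromov_product_def)

lemma tprod_le: "tprod p x y \<le> dist p x"
  using dist_triangle[of p y x] by (simp add: gromov_product_def)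

lemma tprod_ge: "dist p x - dist x y \<le> tprod p x y"
  using dist_triangle2[of p x y] by (simp add: gromov_product_def dist_commute)

lemma tprod_eq_0_iff: "tprod p x y = 0 \<longleftrightarrow> p \<in> seg x y"
  by (auto simp: gromov_product_def mem_seg_iff dist_commute)

lemma tprod_eq_dist_iff: "tprod p x y = dist p x \<longleftrightarrow> x \<in> seg p y"
  by (auto simp: gromov_product_def mem_seg_iff dist_commute)

lemma tprod_basepoint: "\<bar>tprod p x y - tprod q x y\<bar> \<le> dist p q"
proof -
  have "dist p x \<le> dist p q + dist q x" "dist p y \<le> dist p q + dist q y"
    "dist q x \<le> dist p q + dist p x" "dist q y \<le> dist p q + dist p y"
    using dist_triangle[of p x q] dist_triangle[of p y q] dist_triangle[of q x p]
      dist_triangle[of q y p] by (simp_all add: dist_commute)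
  then have "(dist p x + dist p y - dist x y) / 2 - (dist q x + dist q y - dist x y) / 2 \<le> dist p q"
    "- ((dist p x + dist p y - dist x y) / 2 - (dist q x + dist q y - dist x y) / 2) \<le> dist p q"
    by (simp_all add: field_simps)
  then show ?thesis unfolding gromov_product_def by (rule abs_leI)
qed

lemma dist_le_of_seg:
  assumes "w \<in> seg p x" "w \<in> seg p z"
  shows "dist p w \<le> tprod p x z"
  using assms dist_triangle[of x z w] by (simp add: mem_seg_iff gromov_product_def dist_commute)

lemma tprod_le_dist_seg: "z \<in> seg a b \<Longrightarrow> tprod p a b \<le> dist p z"
  using dist_triangle[of p a z] dist_triangle[of p b z]
  by (simp add: mem_seg_iff gromov_product_def dist_commute)

lemma seg_trans: "w \<in> seg p v \<Longrightarrow> v \<in> seg p z \<Longrightarrow> w \<in> seg p z"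
  using dist_triangle[of w z v] dist_triangle[of p z w] by (simp add: mem_seg_iff)

text \<open>The medians of \<open>p, x, u\<close> and of \<open>p, u, z\<close> both lie on \<open>seg p u\<close>. The one nearer to \<open>p\<close> lies on
  \<open>seg p x\<close> and on \<open>seg p z\<close>, so these two segments share an initial piece of that length.\<close>

lemma tprod_ultrametric: "min (tprod p x u) (tprod p u z) \<le> tprod p x z"
proof -
  have *: "tprod p x u \<le> tprod p x z" if le: "tprod p x u \<le> tprod p u z" for x z
  proof -
    let ?v = "median p x u" and ?w = "median p u z"
    have d: "dist p ?v = tprod p x u" "dist p ?w = tprod p u z"
      using median_dist median_in by blast+
    have "dist ?v ?w = dist p ?w - dist p ?v"
      using seg_linear[OF median_in(2)[of p x u] median_in(1)[of p u z]] d le by simp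
    then have "?v \<in> seg p ?w" by (simp add: mem_seg_iff)
    then have "?v \<in> seg p z" using seg_trans median_in(2) by blast
    then show ?thesis using dist_le_of_seg median_in(1)[of p x u] d by metis
  qed
  show ?thesis
    using *[of x z] *[of z x] by (cases "tprod p x u \<le> tprod p u z") (auto simp: tprod_commute)
qed

lemma tprod_ultrametric_ge: "r \<le> tprod p x u \<Longrightarrow> r \<le> tprod p u z \<Longrightarrow> r \<le> tprod p x z"
  using tprod_ultrametric[of p x u z] by linarith

lemma tprod_ultrametric_eq: "tprod p x u < tprod p u z \<Longrightarrow> tprod p x z = tprod p x u"
  using tprod_ultrametric[of p x u z] tprod_ultrametric[of p x z u]
  by (simp add: tprod_commute)

text \<open>Segments issuing from \<open>x\<close> agree up to the Gromov product of their endpoints.\<close>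

lemma mem_seg_of_tprod:
  assumes "y \<in> seg x a" "dist x y \<le> tprod x a b"
  shows "y \<in> seg x b"
proof -
  have "dist x y \<le> tprod x y b"
    using assms tprod_ultrametric_ge[of "dist x y" x y a b] tprod_eq_dist_iff[of x y a] by auto
  then show ?thesis using tprod_le[of x y b] tprod_eq_dist_iff[of x y b] by auto
qed

lemma seg_subset_Un: "seg a c \<subseteq> seg a b \<union> seg b c"
proof
  fix z assume z: "z \<in> seg a c"
  have "0 = tprod z a c" using z tprod_eq_0_iff by metis
  then have "tprod z a b = 0 \<or> tprod z b c = 0"
    using tprod_ultrametric[of z a b c] tprod_nonneg[of z a b] tprod_nonneg[of z b c] by linarith
  then show "z \<in> seg a b \<union> seg b c" by (auto simp: tprod_eq_0_iff)
qed

lemma sub_seg: 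
  assumes "z \<in> seg x y"
  shows "seg x z \<subseteq> seg x y" "seg z y \<subseteq> seg x y"
  using assms seg_trans seg_commute by blast+

text \<open>Two geodesics that overlap in a nondegenerate segment, in compatible directions, glue to a geodesic.\<close>

lemma seg_concat:
  assumes "y \<in> seg x a" "x \<in> seg y b" "x \<noteq> y"
  shows "dist b a = dist b x + dist x y + dist y a"
proof -
  have "tprod x b y = 0" "tprod x y a = dist x y"
    using assms by (auto simp: tprod_eq_0_iff tprod_eq_dist_iff seg_commute)
  then have "tprod x b a = 0" using assms(3) tprod_ultrametric_eq[of x b y a] by simp
  then have "x \<in> seg b a" using tprod_eq_0_iff by blast
  then show ?thesis using assms(1) by (simp add: mem_seg_iff)
qed

section \<open>Gromov products of words\<close>

fun lcp_length :: "'a list \<Rightarrow> 'a list \<Rightarrow> nat" where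
  "lcp_length (x # xs) (y # ys) = (if x = y then Suc (lcp_length xs ys) else 0)"
| "lcp_length _ _ = 0"

lemma lcp_length_le: "lcp_length xs ys \<le> length xs" "lcp_length xs ys \<le> length ys"
  by (induction xs ys rule: lcp_length.induct) auto

lemma lcp_length_take: "n \<le> lcp_length xs ys \<Longrightarrow> take n xs = take n ys"
  by (induction xs ys arbitrary: n rule: lcp_length.induct) (auto simp: take_Cons' split: if_splits)

lemma lcp_length_ultrametric: "min (lcp_length xs ys) (lcp_length ys zs) \<le> lcp_length xs zs"
proof (induction xs zs arbitrary: ys rule: lcp_length.induct)
  case (1 x xs z zs)
  show ?case using "1.IH"[of "tl ys"] by (cases ys) auto
next
  case ("2_1" zs) show ?case by simp
next
  case ("2_2" xs) then show ?case by (cases ys) auto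
qed

definition flip_letter :: "bool \<times> 'g \<Rightarrow> bool \<times> 'g" where
  "flip_letter l = (\<not> fst l, snd l)"

lemma flip_flip [simp]: "flip_letter (flip_letter l) = l"
  by (simp add: flip_letter_def)

lemma flip_eq_iff: "flip_letter l = m \<longleftrightarrow> l = flip_letter m"
  by (auto simp: flip_letter_def)

lemma reduced_word_alt: "reduced_word w \<longleftrightarrow> successively (\<lambda>l m. m \<noteq> flip_letter l) w"
  by (simp add: reduced_word_def flip_letter_def)

definition inverse_word :: "(bool \<times> 'g) list \<Rightarrow> (bool \<times> 'g) list" where
  "inverse_word w = rev (map flip_letter w)"

lemma length_inverse_word [simp]: "length (inverse_word w) = length w"
  by (simp add: inverse_word_def)

lemma reduced_inverse_word: "reduced_word w \<Longrightarrow> reduced_word (inverse_word w)"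
  unfolding reduced_word_alt inverse_word_def successively_rev successively_map
  by (erule successively_mono) auto

locale free_group =
  fixes G (structure) and X
  assumes basis: "free_basis G X"
begin

sublocale group G using basis by (simp add: free_basis_def)

lemma X_sub: "X \<subseteq> carrier G" using basis by (simp add: free_basis_def)

definition letter_value :: "bool \<times> 'a \<Rightarrow> 'a" where
  "letter_value l = (if fst l then snd l else inv (snd l))"

definition words :: "(bool \<times> 'a) list set" where
  "words = lists (UNIV \<times> X)"

lemma words_simps [simp]: "[] \<in> words" "l # w \<in> words \<longleftrightarrow> snd l \<in> X \<and> w \<in> words"
  "u @ v \<in> words \<longleftrightarrow> u \<in> words \<and> v \<in> words"
  by (auto simp: words_def mem_Times_iff)

lemma inverse_word_in_words [simp]: "w \<in> words \<Longrightarrow> inverse_word w \<in> words"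
  by (auto simp: words_def inverse_word_def in_lists_conv_set flip_letter_def)

lemma word_value_Nil [simp]: "word_value G [] = \<one>"
  by (simp add: word_value_def)

lemma word_value_Cons [simp]: "word_value G (l # w) = letter_value l \<otimes> word_value G w"
  by (cases l) (simp add: word_value_def letter_value_def)

lemma letter_value_closed [simp]: "snd l \<in> X \<Longrightarrow> letter_value l \<in> carrier G"
  using X_sub by (auto simp: letter_value_def)

lemma letter_value_flip: "snd l \<in> X \<Longrightarrow> letter_value (flip_letter l) = inv (letter_value l)"
  using X_sub by (auto simp: letter_value_def flip_letter_def)

lemma word_value_closed [simp]: "w \<in> words \<Longrightarrow> word_value G w \<in> carrier G"
  by (induction w) auto

lemma word_value_append [simp]:
  "u \<in> words \<Longrightarrow> v \<in> words \<Longrightarrow> word_value G (u @ v) = word_value G u \<otimes> word_value G v"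
  by (induction u) (auto simp: m_assoc)

lemma word_value_inverse [simp]:
  "w \<in> words \<Longrightarrow> word_value G (inverse_word w) = inv (word_value G w)"
proof (induction w)
  case (Cons l w)
  have "word_value G (inverse_word w @ [flip_letter l]) =
      word_value G (inverse_word w) \<otimes> word_value G [flip_letter l]"
    using Cons.prems by (intro word_value_append) (auto simp: flip_letter_def)
  then show ?case using Cons
    by (simp add: inverse_word_def letter_value_flip inv_mult_group)
qed (simp add: inverse_word_def)

lemma ex1_reduced:
  "g \<in> carrier G \<Longrightarrow> \<exists>!w. w \<in> words \<and> reduced_word w \<and> word_value G w = g"
  using basis by (simp add: free_basis_def words_def)

definition reduced_form :: "'a \<Rightarrow> (bool \<times> 'a) list" where
  "reduced_form g = (THE w. w \<in> words \<and> reduced_word w \<and> word_value G w = g)"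

lemma reduced_form:
  assumes "g \<in> carrier G"
  shows "reduced_form g \<in> words" "reduced_word (reduced_form g)" "word_value G (reduced_form g) = g"
  using theI'[OF ex1_reduced[OF assms]] by (auto simp: reduced_form_def)

lemma reduced_form_word_value:
  "w \<in> words \<Longrightarrow> reduced_word w \<Longrightarrow> reduced_form (word_value G w) = w"
  using ex1_reduced[of "word_value G w"] reduced_form[of "word_value G w"] by auto

lemma ex_shorter_reduced_word:
  "w \<in> words \<Longrightarrow> \<exists>v \<in> words. reduced_word v \<and> word_value G v = word_value G w \<and> length v \<le> length w"
proof (induction w)
  case Nil
  then show ?case by (auto simp: reduced_word_def)
next
  case (Cons l w)
  then obtain v where v: "v \<in> words" "reduced_word v" "word_value G v = word_value G w"
    "length v \<le> length w" by auto
  show ?case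
  proof (cases "\<exists>u. v = flip_letter l # u")
    case True
    then obtain u where u: "v = flip_letter l # u" by blast
    have "letter_value l \<otimes> (inv (letter_value l) \<otimes> word_value G u) = word_value G u"
      using Cons.prems v(1) u by (simp flip: m_assoc)
    then have "word_value G u = word_value G (l # w)"
      using v u Cons.prems by (simp add: letter_value_flip flip: v(3))
    then show ?thesis using v u by (intro bexI[of _ u]) (auto simp: reduced_word_def successively_Cons)
  next
    case False
    then have "reduced_word (l # v)"
      using v(2) by (cases v) (auto simp: reduced_word_alt)
    moreover have "l # v \<in> words" "word_value G (l # v) = word_value G (l # w)"
      "length (l # v) \<le> length (l # w)"
      using v Cons.prems by simp_all
    ultimately show ?thesis by blast
  qed
qed

lemma word_length_reduced:
  assumes "w \<in> words" "reduced_word w"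
  shows "word_length G X (word_value G w) = length w"
  unfolding word_length_def
proof (rule Least_equality)
  show "\<exists>u\<in>lists (UNIV \<times> X). length u = length w \<and> word_value G u = word_value G w"
    using assms by (auto simp: words_def)
next
  fix n assume "\<exists>u\<in>lists (UNIV \<times> X). length u = n \<and> word_value G u = word_value G w"
  then obtain u where u: "u \<in> words" "length u = n" "word_value G u = word_value G w"
    by (auto simp: words_def)
  obtain v where v: "v \<in> words" "reduced_word v" "word_value G v = word_value G u" "length v \<le> length u"
    using ex_shorter_reduced_word[OF u(1)] by blast
  have "v = w"
    using reduced_form_word_value[OF v(1,2)] reduced_form_word_value[OF assms] v(3) u(3) by metis
  then show "length w \<le> n" using v(4) u(2) by blast
qed

text \<open>Without a common first letter nothing cancels: \<open>inverse_word u @ v\<close> is reduced.\<close>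

lemma word_length_quotient_disjoint:
  assumes "u \<in> words" "reduced_word u" "v \<in> words" "reduced_word v"
    and hd: "u = [] \<or> v = [] \<or> hd u \<noteq> hd v"
  shows "word_length G X (inv (word_value G u) \<otimes> word_value G v) = length u + length v"
proof -
  have "u = [] \<or> last (inverse_word u) = flip_letter (hd u)"
    by (cases u) (auto simp: inverse_word_def)
  then have "reduced_word (inverse_word u @ v)"
    using assms reduced_inverse_word[of u]
    unfolding reduced_word_alt successively_append_iff flip_eq_iff
    by (auto simp: inverse_word_def)
  then show ?thesis
    using word_length_reduced[of "inverse_word u @ v"] assms by simp
qed

text \<open>The common prefix cancels and nothing else does. In other words, the Gromov product of two elements
  is the length of the longest common prefix of their reduced words.\<close>

lemma word_length_quotient:
  assumes "u \<in> words" "reduced_word u" "v \<in> words" "reduced_word v"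
  shows "word_length G X (inv (word_value G u) \<otimes> word_value G v) + 2 * lcp_length u v = length u + length v"
  using assms
proof (induction u v rule: lcp_length.induct)
  case (1 x xs y ys)
    show ?case
    proof (cases "x = y")
      case True
      let ?a = "letter_value x" and ?g = "word_value G xs" and ?h = "word_value G ys"
      have c: "?a \<in> carrier G" "?g \<in> carrier G" "?h \<in> carrier G" using "1.prems" by auto
      have "inv (?a \<otimes> ?g) \<otimes> (?a \<otimes> ?h) = inv ?g \<otimes> (inv ?a \<otimes> (?a \<otimes> ?h))"
        using c by (simp add: inv_mult_group m_assoc)
      also have "inv ?a \<otimes> (?a \<otimes> ?h) = ?h" using c by (simp flip: m_assoc)
      finally show ?thesis
        using "1.IH"[OF True] "1.prems" True by (auto simp: reduced_word_def successively_Cons)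
    next
      case False
      then show ?thesis using word_length_quotient_disjoint[OF "1.prems"] by simp
    qed
  next
    case ("2_1" v) then show ?case using word_length_quotient_disjoint[of "[]" v] by (simp add: reduced_word_def)
  next
    case ("2_2" u) then show ?case using word_length_quotient_disjoint[of u "[]"] by (simp add: reduced_word_def)
qed

abbreviation wprod :: "'a \<Rightarrow> 'a \<Rightarrow> real" where
  "wprod \<equiv> gromov_product (word_dist G X) \<one>"

abbreviation wlen :: "'a \<Rightarrow> nat" where
  "wlen \<equiv> word_length G X"

lemma wlen_reduced_form: "g \<in> carrier G \<Longrightarrow> wlen g = length (reduced_form g)"
  using word_length_reduced[of "reduced_form g"] reduced_form[of g] by simp

lemma wprod_eq_lcp_length:
  assumes "g \<in> carrier G" "h \<in> carrier G"
  shows "wprod g h = lcp_length (reduced_form g) (reduced_form h)"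
  using word_length_quotient[of "reduced_form g" "reduced_form h"] reduced_form[OF assms(1)]
    reduced_form[OF assms(2)] assms wlen_reduced_form[OF assms(1)] wlen_reduced_form[OF assms(2)]
  by (simp add: gromov_product_def word_dist_def)

lemma wprod_ultrametric_ge:
  assumes "g \<in> carrier G" "h \<in> carrier G" "k \<in> carrier G" "r \<le> wprod g h" "r \<le> wprod h k"
  shows "r \<le> wprod g k"
  using lcp_length_ultrametric[of "reduced_form g" "reduced_form h" "reduced_form k"] assms
  by (auto simp: wprod_eq_lcp_length)

lemma wprod_eq_wlen:
  "g \<in> carrier G \<Longrightarrow> h \<in> carrier G \<Longrightarrow>
     wprod g h = (real (wlen g) + real (wlen h) - real (wlen (inv g \<otimes> h))) / 2"
  by (simp add: gromov_product_def word_dist_def)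

lemma basis_not_commute:
  assumes "x \<in> X" "y \<in> X" "x \<noteq> y"
  shows "x \<otimes> y \<noteq> y \<otimes> x"
proof
  assume eq: "x \<otimes> y = y \<otimes> x"
  let ?u = "[(True, x), (True, y)]" and ?v = "[(True, y), (True, x)]"
  have "?u \<in> words" "?v \<in> words" "reduced_word ?u" "reduced_word ?v"
    using assms by (auto simp: reduced_word_def)
  moreover have "word_value G ?u = word_value G ?v"
    using eq assms(1,2) X_sub by (simp add: letter_value_def subset_iff)
  ultimately have "?u = ?v" using reduced_form_word_value by metis
  then show False using assms by simp
qed

end

section \<open>Ends, rays and lines in a tree\<close>

lemma filterlim_at_top_prod_sequentially:
  fixes f :: "nat \<Rightarrow> nat \<Rightarrow> real"
  shows "filterlim (\<lambda>(i, j). f i j) at_top (sequentially \<times>\<^sub>F sequentially) \<longleftrightarrow>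
    (\<forall>M. \<exists>N. \<forall>i\<ge>N. \<forall>j\<ge>N. M \<le> f i j)"
  unfolding filterlim_at_top eventually_prod_sequentially split_conv by blast

lemma gromov_seq_iff: "gromov_seq S d p x \<longleftrightarrow> range x \<subseteq> S \<and>
    (\<forall>M. \<exists>N. \<forall>i\<ge>N. \<forall>j\<ge>N. M \<le> gromov_product d p (x i) (x j))"
  unfolding gromov_seq_def filterlim_at_top_prod_sequentially ..

lemma gromov_equiv_iff: "gromov_equiv S d p x y \<longleftrightarrow> gromov_seq S d p x \<and> gromov_seq S d p y \<and>
    (\<forall>M. \<exists>N. \<forall>i\<ge>N. \<forall>j\<ge>N. M \<le> gromov_product d p (x i) (y j))"
  unfolding gromov_equiv_def filterlim_at_top_prod_sequentially ..

text \<open>\<open>U\<close> and \<open>W\<close> converge to the same end of the tree; \<open>asymptotic U U\<close> says that \<open>U\<close> converges to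
  some end.\<close>

definition asymptotic :: "(nat \<Rightarrow> 't::real_tree) \<Rightarrow> (nat \<Rightarrow> 't) \<Rightarrow> bool" where
  "asymptotic U W \<longleftrightarrow> (\<forall>p M. \<exists>N. \<forall>i\<ge>N. \<forall>j\<ge>N. M \<le> tprod p (U i) (W j))"

lemma asymptoticD:
  "asymptotic U W \<Longrightarrow> \<exists>N. \<forall>i\<ge>N. \<forall>j\<ge>N. M \<le> tprod p (U i) (W j)"
  unfolding asymptotic_def by blast

text \<open>A change of the base point changes Gromov products by a bounded amount, so one base point suffices.\<close>

lemma asymptotic_iff: "asymptotic U W \<longleftrightarrow> (\<forall>M. \<exists>N. \<forall>i\<ge>N. \<forall>j\<ge>N. M \<le> tprod p (U i) (W j))"
proof
  assume *: "\<forall>M. \<exists>N. \<forall>i\<ge>N. \<forall>j\<ge>N. M \<le> tprod p (U i) (W j)"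
  show "asymptotic U W"
    unfolding asymptotic_def
  proof (intro allI)
    fix q M
    from * obtain N where N: "\<forall>i\<ge>N. \<forall>j\<ge>N. M + dist p q \<le> tprod p (U i) (W j)" by blast
    have "M \<le> tprod q (U i) (W j)" if "N \<le> i" "N \<le> j" for i j
    proof -
      have "M + dist p q \<le> tprod p (U i) (W j)" using N that by blast
      then show ?thesis using tprod_basepoint[of p "U i" "W j" q] by linarith
    qed
    then show "\<exists>N. \<forall>i\<ge>N. \<forall>j\<ge>N. M \<le> tprod q (U i) (W j)" by blast
  qed
qed (simp add: asymptotic_def)

lemma asymptotic_sym: "asymptotic U W \<Longrightarrow> asymptotic W U"
  unfolding asymptotic_def tprod_commute[of _ "W _"] by blast

lemma asymptotic_trans:
  assumes "asymptotic U V" "asymptotic V W"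
  shows "asymptotic U W"
  unfolding asymptotic_def
proof (intro allI)
  fix p M
  obtain N1 where N1: "\<And>i j. N1 \<le> i \<Longrightarrow> N1 \<le> j \<Longrightarrow> M \<le> tprod p (U i) (V j)"
    using asymptoticD[OF assms(1)] by blast
  obtain N2 where N2: "\<And>i j. N2 \<le> i \<Longrightarrow> N2 \<le> j \<Longrightarrow> M \<le> tprod p (V i) (W j)"
    using asymptoticD[OF assms(2)] by blast
  have "M \<le> tprod p (U i) (W j)" if "max N1 N2 \<le> i" "max N1 N2 \<le> j" for i j
    using tprod_ultrametric_ge[OF N1[of i "max N1 N2"] N2[of "max N1 N2" j]] that by auto
  then show "\<exists>N. \<forall>i\<ge>N. \<forall>j\<ge>N. M \<le> tprod p (U i) (W j)" by blast
qed

lemma asymptotic_refl: "asymptotic U W \<Longrightarrow> asymptotic U U"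
  by (rule asymptotic_trans[OF _ asymptotic_sym])

lemma gromov_equiv_tree_iff: "gromov_equiv UNIV dist p U W \<longleftrightarrow> asymptotic U W"
proof -
  have "gromov_equiv UNIV dist p U W \<longleftrightarrow> asymptotic U U \<and> asymptotic W W \<and> asymptotic U W"
    unfolding asymptotic_iff[of _ _ p] gromov_equiv_iff gromov_seq_iff by simp
  then show ?thesis using asymptotic_refl asymptotic_sym by blast
qed

lemma asymptotic_bounded_dist:
  assumes "asymptotic U U" "\<And>n. dist (U n) (V n) \<le> C"
  shows "asymptotic U V"
  unfolding asymptotic_def
proof (intro allI)
  fix p M
  obtain N where N: "\<And>i j. N \<le> i \<Longrightarrow> N \<le> j \<Longrightarrow> M + C \<le> tprod p (U i) (U j)"
    using asymptoticD[OF assms(1)] by blast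
  have "M \<le> tprod p (U i) (V j)" if "N \<le> i" "N \<le> j" for i j
  proof -
    have "M + C \<le> tprod p (U i) (U j)" using N that .
    moreover have "dist p (U j) \<le> dist p (V j) + C" "dist (U i) (V j) \<le> dist (U i) (U j) + C"
      using assms(2)[of j] dist_triangle2[of p "U j" "V j"] dist_triangle[of "U i" "V j" "U j"]
      by auto
    ultimately show ?thesis by (simp add: gromov_product_def field_simps)
  qed
  then show "\<exists>N. \<forall>i\<ge>N. \<forall>j\<ge>N. M \<le> tprod p (U i) (V j)" by blast
qed

text \<open>The segments from \<open>q\<close> to the points of the sequence agree on longer and longer initial pieces. The ray is
  made of these pieces.\<close>

lemma ex_ray:
  assumes "asymptotic U U"
  shows "\<exists>r. \<forall>t\<ge>0. dist q (r t) = t \<and> (\<exists>N. \<forall>i\<ge>N. r t \<in> seg q (U i))"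
proof -
  have "\<exists>z. dist q z = t \<and> (\<exists>N. \<forall>i\<ge>N. z \<in> seg q (U i))" if "0 \<le> t" for t
  proof -
    obtain N where N: "\<And>i j. N \<le> i \<Longrightarrow> N \<le> j \<Longrightarrow> t \<le> tprod q (U i) (U j)"
      using asymptoticD[OF assms] by blast
    have "t \<le> dist q (U N)" using N[of N N] tprod_le[of q "U N" "U N"] by simp
    then obtain z where z: "z \<in> seg q (U N)" "dist q z = t" using seg_at_dist \<open>0 \<le> t\<close> by metis
    have "z \<in> seg q (U i)" if "N \<le> i" for i
      using mem_seg_of_tprod[OF z(1)] N[of N i] z(2) that by simp
    with z show ?thesis by blast
  qed
  then show ?thesis by metis
qed

text \<open>The line consists of the two rays from \<open>q\<close> to the ends of \<open>U\<close> and \<open>W\<close>; the hypothesis says that they leave \<open>q\<close>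
  in different directions. The last conclusion locates points beyond \<open>q\<close> on this line.\<close>

lemma ex_line:
  fixes U W :: "nat \<Rightarrow> 't::real_tree"
  assumes U: "asymptotic U U" and W: "asymptotic W W"
    and q: "\<And>i j. N \<le> i \<Longrightarrow> N \<le> j \<Longrightarrow> q \<in> seg (U i) (W j)"
  obtains c where "geodesic_line c" "c 0 = q" "asymptotic U (\<lambda>n. c (- real n))"
    "asymptotic W (\<lambda>n. c (real n))"
    "\<And>y N. (\<And>j. N \<le> j \<Longrightarrow> y \<in> seg q (W j)) \<Longrightarrow> c (dist q y) = y"
proof -
  have to_end: "asymptotic V (\<lambda>n. r (real n))"
    if V: "asymptotic V V" and r: "\<forall>t\<ge>0. dist q (r t) = t \<and> (\<exists>N. \<forall>i\<ge>N. r t \<in> seg q (V i))"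
    for V :: "nat \<Rightarrow> 't" and r :: "real \<Rightarrow> 't"
    unfolding asymptotic_iff[of _ _ q]
  proof (intro allI)
    fix M
    obtain N where N: "\<And>i j. N \<le> i \<Longrightarrow> N \<le> j \<Longrightarrow> M \<le> tprod q (V i) (V j)"
      using asymptoticD[OF V] by blast
    have "M \<le> tprod q (V i) (r (real n))" if i: "max N (nat \<lceil>M\<rceil>) \<le> i" and n: "max N (nat \<lceil>M\<rceil>) \<le> n" for i n
    proof -
      from r obtain N' where N': "\<forall>i\<ge>N'. r (real n) \<in> seg q (V i)" by (meson of_nat_0_le_iff)
      define k where "k = max N N'"
      have "tprod q (r (real n)) (V k) = real n"
        using N' r by (auto simp: k_def tprod_eq_dist_iff[symmetric])
      then have "M \<le> tprod q (V k) (r (real n))" using n by (simp add: tprod_commute)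
      moreover have "M \<le> tprod q (V i) (V k)" using N[of i k] i by (simp add: k_def)
      ultimately show ?thesis using tprod_ultrametric_ge by blast
    qed
    then show "\<exists>N. \<forall>i\<ge>N. \<forall>j\<ge>N. M \<le> tprod q (V i) (r (real j))" by blast
  qed
  obtain u where u: "\<forall>t\<ge>0. dist q (u t) = t \<and> (\<exists>N. \<forall>i\<ge>N. u t \<in> seg q (U i))"
    using ex_ray[OF U] by blast
  obtain w where w: "\<forall>t\<ge>0. dist q (w t) = t \<and> (\<exists>N. \<forall>i\<ge>N. w t \<in> seg q (W i))"
    using ex_ray[OF W] by blast
  have u0: "u 0 = q" and w0: "w 0 = q" using u w by auto
  have same: "dist (r s) (r t) = \<bar>s - t\<bar>"
    if r: "\<forall>t\<ge>0. dist q (r t) = t \<and> (\<exists>N. \<forall>i\<ge>N. r t \<in> seg q (V i))" and st: "0 \<le> s" "0 \<le> t"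
    for r :: "real \<Rightarrow> 't" and V :: "nat \<Rightarrow> 't" and s t
  proof -
    obtain N1 N2 where "\<forall>i\<ge>N1. r s \<in> seg q (V i)" "\<forall>i\<ge>N2. r t \<in> seg q (V i)"
      using r st by blast
    then have "r s \<in> seg q (V (max N1 N2))" "r t \<in> seg q (V (max N1 N2))" by auto
    from seg_linear[OF this] show ?thesis using r st by simp
  qed
  have opp: "dist (u s) (w t) = s + t" if st: "0 \<le> s" "0 \<le> t" for s t
  proof -
    obtain N1 N2 where "\<forall>i\<ge>N1. u s \<in> seg q (U i)" "\<forall>i\<ge>N2. w t \<in> seg q (W i)"
      using u w st by blast
    moreover define k where "k = max N (max N1 N2)"
    ultimately have k: "u s \<in> seg q (U k)" "w t \<in> seg q (W k)" "N \<le> k" by auto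
    have "dist (u s) (w t) \<le> dist (u s) q + dist q (w t)" by (rule dist_triangle)
    moreover have "dist (U k) (W k) \<le> dist (U k) (u s) + dist (u s) (w t) + dist (w t) (W k)"
      using dist_triangle[of "U k" "W k" "u s"] dist_triangle[of "u s" "W k" "w t"] by linarith
    moreover have "dist q (u s) = s" "dist q (w t) = t" using u w st by auto
    ultimately show ?thesis
      using k q[OF k(3) k(3)] dist_commute[of q "U k"] dist_commute[of q "u s"]
        dist_commute[of "U k" "u s"]
      unfolding mem_seg_iff by linarith
  qed
  have opp': "dist (w t) (u s) = s + t" if "0 \<le> s" "0 \<le> t" for s t
    using opp[OF that] by (simp add: dist_commute)
  define c where "c t = (if t < 0 then u (- t) else w t)" for t
  have cneg: "c (- t) = u t" if "0 \<le> t" for t using that u0 w0 by (auto simp: c_def)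
  have cpos: "c t = w t" if "0 \<le> t" for t using that by (simp add: c_def)
  show ?thesis
  proof
    show "geodesic_line c"
      unfolding geodesic_line_def c_def
      using opp opp' same[OF u] same[OF w] by auto
    show "c 0 = q" using w0 by (simp add: c_def)
    show "asymptotic U (\<lambda>n. c (- real n))" "asymptotic W (\<lambda>n. c (real n))"
      using to_end[OF U u] to_end[OF W w] by (simp_all add: cneg cpos)
    fix y N assume y: "\<And>j. N \<le> j \<Longrightarrow> y \<in> seg q (W j)"
    obtain N' where "\<forall>i\<ge>N'. w (dist q y) \<in> seg q (W i)"
      using w[rule_format, OF zero_le_dist[of q y]] by blast
    then have "w (dist q y) \<in> seg q (W (max N N'))" "y \<in> seg q (W (max N N'))" using y by auto
    from seg_linear[OF this] have "dist (w (dist q y)) y = 0"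
      using w[rule_format, OF zero_le_dist[of q y]] by simp
    then show "c (dist q y) = y" using cpos[of "dist q y"] by simp
  qed
qed

text \<open>For two sequences with different ends, the ultrametric inequality makes \<open>tprod p (U i) (W j)\<close> eventually constant,
  and the segments from \<open>p\<close> to \<open>U i\<close> and \<open>W j\<close> branch at a point independent of \<open>i\<close> and \<open>j\<close>.\<close>

lemma ex_separating_point:
  fixes U W :: "nat \<Rightarrow> 't::real_tree"
  assumes U: "asymptotic U U" and W: "asymptotic W W" and "\<not> asymptotic U W"
  shows "\<exists>q N. \<forall>i\<ge>N. \<forall>j\<ge>N. q \<in> seg (U i) (W j)"
proof -
  from assms(3) obtain p M where M: "\<And>N. \<exists>i\<ge>N. \<exists>j\<ge>N. tprod p (U i) (W j) < M"
    unfolding asymptotic_def by (meson not_le)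
  obtain N1 where N1: "\<And>i j. N1 \<le> i \<Longrightarrow> N1 \<le> j \<Longrightarrow> M \<le> tprod p (U i) (U j)"
    using asymptoticD[OF U] by blast
  obtain N2 where N2: "\<And>i j. N2 \<le> i \<Longrightarrow> N2 \<le> j \<Longrightarrow> M \<le> tprod p (W i) (W j)"
    using asymptoticD[OF W] by blast
  define N where "N = max N1 N2"
  obtain i0 j0 where ij0: "N \<le> i0" "N \<le> j0" and l: "tprod p (U i0) (W j0) < M"
    using M[of N] by blast
  define q where "q = median p (U i0) (W j0)"
  have q: "q \<in> seg p (U i0)" "q \<in> seg p (W j0)" "dist p q = tprod p (U i0) (W j0)"
    using median_in[of p "U i0" "W j0"] median_dist[of q p "U i0" "W j0"] by (auto simp: q_def)
  have "q \<in> seg (U i) (W j)" if "N \<le> i" "N \<le> j" for i j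
  proof -
    have Ui: "M \<le> tprod p (U i0) (U i)" using N1 that ij0 by (auto simp: N_def)
    have Wj: "M \<le> tprod p (W j0) (W j)" using N2 that ij0 by (auto simp: N_def)
    have "tprod p (U i) (W j0) = dist p q"
      using tprod_ultrametric_eq[of p "W j0" "U i0" "U i"] Ui l q(3) by (simp add: tprod_commute)
    then have "tprod p (U i) (W j) = dist p q"
      using tprod_ultrametric_eq[of p "U i" "W j0" "W j"] Wj l q(3) by simp
    moreover have "q \<in> seg p (U i)" "q \<in> seg p (W j)"
      using mem_seg_of_tprod[OF q(1), of "U i"] mem_seg_of_tprod[OF q(2), of "W j"] Ui Wj l q(3)
      by auto
    ultimately show ?thesis
      by (auto simp: mem_seg_iff gromov_product_def dist_commute field_simps)
  qed
  then show ?thesis by blast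
qed

text \<open>Beyond \<open>y\<close>, the points of the line and of \<open>W\<close> are seen from \<open>x\<close> in the same direction up to distance
  \<open>dist x y\<close>.\<close>

lemma line_eventually_through:
  assumes c: "geodesic_line c" "asymptotic (\<lambda>n. c (real n)) W" and st: "c s = x" "c t = y" "s < t"
  obtains N where "\<And>j. N \<le> j \<Longrightarrow> y \<in> seg x (W j)"
proof -
  obtain N where N: "\<And>i j. N \<le> i \<Longrightarrow> N \<le> j \<Longrightarrow> dist x y \<le> tprod x (c (real i)) (W j)"
    using asymptoticD[OF c(2)] by blast
  define n where "n = max N (nat \<lceil>t\<rceil>)"
  have "t \<le> real n" by (simp add: n_def) linarith
  then have "y \<in> seg x (c (real n))"
    using c(1) st by (auto simp: mem_seg_iff geodesic_line_def)
  then have "y \<in> seg x (W j)" if "N \<le> j" for j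
    using mem_seg_of_tprod N[of n j] that by (simp add: n_def)
  then show ?thesis using that by blast
qed

lemma geodesic_line_reverse: "geodesic_line c \<Longrightarrow> geodesic_line (\<lambda>t. c (- t))"
  by (auto simp: geodesic_line_def)

section \<open>Branch points\<close>

text \<open>The projection to the line of a vertex near \<open>c (a + D)\<close> is that vertex itself or a branch point, and the
  projection does not increase the distance to \<open>c (a + D)\<close>.\<close>

lemma vertex_near_line:
  fixes c :: "real \<Rightarrow> 't::real_tree"
  assumes c: "geodesic_line c" and D: "\<And>x::'t. \<exists>v. tree_vertex v \<and> dist x v \<le> D"
  obtains t where "a \<le> t" "t \<le> a + 2 * D" "tree_vertex (c t)"
proof -
  obtain v where v: "tree_vertex v" "dist (c (a + D)) v \<le> D" using D by blast
  have "0 \<le> D" using v(2) zero_le_dist order_trans by blast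
  \<comment> \<open>The margin of one keeps the projection away from the endpoints of the segment.\<close>
  let ?A = "c (a - 1)" and ?B = "c (a + 2 * D + 1)" and ?m = "c (a + D)"
  have dc: "dist (c s) (c t) = \<bar>s - t\<bar>" for s t using c by (simp add: geodesic_line_def)
  define w where "w = median ?A ?B v"
  have w: "w \<in> seg ?A ?B" "w \<in> seg ?A v" "w \<in> seg ?B v" using median_in by (auto simp: w_def)
  define t where "t = a - 1 + dist ?A w"
  have AB: "dist ?A ?B = 2 * D + 2" using \<open>0 \<le> D\<close> by (simp add: dc)
  have t1: "dist ?A w \<le> 2 * D + 2" using w(1) AB by (simp add: mem_seg_iff) (metis zero_le_dist le_add_same_cancel1)
  have tB: "t \<le> a + 2 * D + 1" using t1 by (simp add: t_def)
  have ct: "c t \<in> seg ?A ?B" using t1 AB by (simp add: mem_seg_iff dc t_def)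
  have "w = c t"
    using seg_linear[OF w(1) ct] by (simp add: dc t_def)
  have m: "?m \<in> seg ?A ?B" using \<open>0 \<le> D\<close> by (simp add: mem_seg_iff dc)
  have "\<bar>t - (a + D)\<bar> \<le> D"
  proof (cases "a + D \<le> t")
    case True
    then have "?m \<in> seg ?A w" using \<open>w = c t\<close> \<open>0 \<le> D\<close> by (simp add: mem_seg_iff dc)
    moreover have "dist ?A v \<le> dist ?A ?m + dist ?m v" by (rule dist_triangle)
    ultimately have "dist ?m w \<le> dist ?m v" using w(2) zero_le_dist[of w v] unfolding mem_seg_iff by linarith
    moreover have "dist ?m w = \<bar>a + D - t\<bar>" unfolding \<open>w = c t\<close> dc ..
    ultimately show ?thesis using v(2) by linarith
  next
    case False
    then have "?m \<in> seg ?B w"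
      using \<open>w = c t\<close> \<open>0 \<le> D\<close> tB by (simp add: mem_seg_iff dc)
    moreover have "dist ?B v \<le> dist ?B ?m + dist ?m v" by (rule dist_triangle)
    ultimately have "dist ?m w \<le> dist ?m v" using w(3) zero_le_dist[of w v] unfolding mem_seg_iff by linarith
    moreover have "dist ?m w = \<bar>a + D - t\<bar>" unfolding \<open>w = c t\<close> dc ..
    ultimately show ?thesis using v(2) by linarith
  qed
  then have t: "a \<le> t" "t \<le> a + 2 * D" by auto
  have "tree_vertex w"
  proof (cases "w = v")
    case False
    have "dist w ?A > 0" "dist w ?B > 0" using t \<open>w = c t\<close> by (simp_all add: dc)
    then have "?A \<noteq> w" "?B \<noteq> w" by auto
    with False w show ?thesis
      unfolding tree_vertex_def by (intro exI[of _ ?A] exI[of _ ?B] exI[of _ v]) auto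
  qed (use v in simp)
  with t \<open>w = c t\<close> show ?thesis using that by blast
qed

text \<open>Without branch points a tree is an interval: fix \<open>p \<noteq> q\<close> and measure the distance to
  \<open>p\<close>, with positive sign on the side of \<open>q\<close>.\<close>

lemma embedding_of_no_vertex:
  assumes nv: "\<And>x::'t::real_tree. \<not> tree_vertex x"
  shows "\<exists>\<phi> :: 't \<Rightarrow> real. \<forall>z w. \<bar>\<phi> z - \<phi> w\<bar> = dist z w"
proof (cases "\<exists>p q :: 't. p \<noteq> q")
  case False
  then show ?thesis by (intro exI[of _ "\<lambda>_. 0"]) (metis diff_self abs_zero dist_self)
next
  case True
  then obtain p q :: 't where "p \<noteq> q" by blast
  have collinear: "median p z w \<in> {p, z, w}" for z w
    using nv[of "median p z w"] median_in[of p z w] unfolding tree_vertex_def by (metis insertCI)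
  define \<phi> where "\<phi> z = (if p \<in> seg z q then - dist p z else dist p z)" for z
  have opp: "dist z w = dist p z + dist p w" if "p \<in> seg z w" for z w
    using that by (simp add: mem_seg_iff dist_commute)
  have same: "dist z w = \<bar>dist p z - dist p w\<bar>" if "p \<notin> seg z w" for z w
  proof -
    have "median p z w = z \<or> median p z w = w"
      using collinear[of z w] median_in(3)[of p z w] that by auto
    then have "z \<in> seg p w \<or> w \<in> seg p z" using median_in[of p z w] by metis
    then show ?thesis
    proof
      assume "z \<in> seg p w"
      then show ?thesis using zero_le_dist[of z w] unfolding mem_seg_iff by linarith
    next
      assume "w \<in> seg p z"
      then show ?thesis
        using zero_le_dist[of z w] dist_commute[of z w] unfolding mem_seg_iff by linarith
    qed
  qed
  have "\<bar>\<phi> z - \<phi> w\<bar> = dist z w" for z w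
  proof (cases "p = z \<or> p = w")
    case True
    then show ?thesis by (auto simp: \<phi>_def dist_commute)
  next
    case False
    then have ne: "z \<noteq> p" "w \<noteq> p" "q \<noteq> p" using \<open>p \<noteq> q\<close> by auto
    have zero: "tprod p x y = 0 \<longleftrightarrow> p \<in> seg x y" for x y by (rule tprod_eq_0_iff)
    consider "p \<in> seg z q" "p \<in> seg w q" | "p \<notin> seg z q" "p \<notin> seg w q"
      | "p \<in> seg z q" "p \<notin> seg w q" | "p \<notin> seg z q" "p \<in> seg w q" by blast
    then show ?thesis
    proof cases
      case 1
      have "p \<notin> seg z w" using 1 ne nv[of p] unfolding tree_vertex_def by metis
      then show ?thesis using same[of z w] 1 by (simp add: \<phi>_def)
    next
      case 2
      then have "0 < tprod p z q" "0 < tprod p q w"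
        using zero tprod_nonneg[of p z q] tprod_nonneg[of p q w] tprod_commute[of p q w]
        by (metis less_eq_real_def)+
      then have "p \<notin> seg z w" using tprod_ultrametric[of p z q w] zero[of z w] by linarith
      then show ?thesis using same[of z w] 2 by (simp add: \<phi>_def)
    next
      case 3
      then have "tprod p z q < tprod p q w"
        using zero[of z q] zero[of w q] tprod_nonneg[of p w q] tprod_commute[of p q w] by linarith
      then have "p \<in> seg z w" using tprod_ultrametric_eq[of p z q w] 3 zero by metis
      moreover have "\<phi> z = - dist p z" "\<phi> w = dist p w" using 3 by (simp_all add: \<phi>_def)
      ultimately show ?thesis using opp[of z w] zero_le_dist[of p z] zero_le_dist[of p w] by linarith
    next
      case 4
      then have "tprod p w q < tprod p q z"
        using zero[of z q] zero[of w q] tprod_nonneg[of p z q] tprod_commute[of p q z] by linarith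
      then have "p \<in> seg w z" using tprod_ultrametric_eq[of p w q z] 4 zero by metis
      moreover have "\<phi> w = - dist p w" "\<phi> z = dist p z" using 4 by (simp_all add: \<phi>_def)
      ultimately show ?thesis
        using opp[of w z] zero_le_dist[of p z] zero_le_dist[of p w] dist_commute[of z w] by linarith
    qed
  qed
  then show ?thesis by blast
qed

text \<open>A reflection of an interval fixes the midpoint of each point and its image, so an isometry without fixed
  points is a translation.\<close>

lemma translation_of_no_fixpoint:
  fixes \<phi> :: "'t::real_tree \<Rightarrow> real"
  assumes \<phi>: "\<And>z w. \<bar>\<phi> z - \<phi> w\<bar> = dist z w"
    and f: "\<And>z w. dist (f z) (f w) = dist z w" "\<And>z. f z \<noteq> z"
  shows "\<phi> (f z) - \<phi> z = \<phi> (f w) - \<phi> w"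
proof (rule ccontr)
  assume ne: "\<phi> (f z) - \<phi> z \<noteq> \<phi> (f w) - \<phi> w"
  have iso: "\<bar>\<phi> (f x) - \<phi> (f y)\<bar> = \<bar>\<phi> x - \<phi> y\<bar>" for x y using \<phi> f(1) by simp
  have refl: "\<phi> (f z) + \<phi> z = \<phi> (f w) + \<phi> w" "\<phi> (f z) \<noteq> \<phi> (f w)"
    using ne iso[of z w] by linarith+
  obtain m where m: "m \<in> seg z (f z)" "dist z m = dist z (f z) / 2"
    using seg_at_dist[of "dist z (f z) / 2" z "f z"] by auto
  have "\<bar>\<phi> z - \<phi> m\<bar> = \<bar>\<phi> z - \<phi> (f z)\<bar> / 2" "\<bar>\<phi> m - \<phi> (f z)\<bar> = \<bar>\<phi> z - \<phi> (f z)\<bar> / 2"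
    using m \<phi> by (simp_all add: mem_seg_iff)
  then have "\<phi> m = (\<phi> z + \<phi> (f z)) / 2" by argo
  with iso[of m z] iso[of m w] refl have "\<phi> (f m) = \<phi> m" by argo
  then have "f m = m" using \<phi>[of "f m" m] by simp
  with f(2) show False by blast
qed

text \<open>If \<open>w\<close> separated \<open>c\<close> from both endpoints, the segment through \<open>c\<close> would pass \<open>w\<close> twice. So the
  direction of \<open>c\<close> at \<open>w\<close> is that of an endpoint.\<close>

lemma direction_endpoint:
  assumes "c \<in> seg u v" "w \<noteq> c"
  shows "0 < tprod w c u \<or> 0 < tprod w c v"
proof (rule ccontr)
  assume "\<not> ?thesis"
  then have "w \<in> seg c u" "w \<in> seg c v"
    using tprod_nonneg[of w c u] tprod_nonneg[of w c v] tprod_eq_0_iff by (metis not_less nle_le)+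
  moreover have "dist u v \<le> dist u w + dist w v" by (rule dist_triangle)
  ultimately have "dist c w \<le> 0"
    using assms(1) dist_commute[of u c] dist_commute[of u w] unfolding mem_seg_iff by linarith
  with assms(2) show False by simp
qed

lemma same_direction:
  assumes "0 < tprod w c u" "w \<in> seg c a"
  shows "w \<in> seg u a"
proof -
  have "tprod w a c = 0" using assms(2) tprod_eq_0_iff tprod_commute by metis
  then have "tprod w a u = 0" using tprod_ultrametric_eq[of w a c u] assms(1) by simp
  then show ?thesis using tprod_eq_0_iff seg_commute by blast
qed

text \<open>Of three directions at \<open>w\<close>, at most one is that of \<open>a\<close> and at most one is that of
  \<open>b\<close>; a third one is left.\<close>

lemma branch_off:
  assumes "tree_vertex w"
  obtains c where "c \<noteq> w" "w \<in> seg c a" "w \<in> seg c b"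
proof -
  from assms obtain c1 c2 c3 where c: "c1 \<noteq> w" "c2 \<noteq> w" "c3 \<noteq> w"
    "w \<in> seg c1 c2" "w \<in> seg c2 c3" "w \<in> seg c1 c3" unfolding tree_vertex_def by blast
  have excl: "w \<in> seg x e \<or> w \<in> seg y e" if "w \<in> seg x y" for x y e
    using seg_subset_Un[of x y e] that seg_commute[of e y] by blast
  show ?thesis
    using that[of c1] that[of c2] that[of c3] c(1-3) excl[OF c(4), of a] excl[OF c(4), of b]
      excl[OF c(5), of a] excl[OF c(5), of b] excl[OF c(6), of a] excl[OF c(6), of b]
    by argo
qed

section \<open>Cocompactness and properness of the action\<close>

locale tree_action = free_group G X for G (structure) and X +
  fixes act :: "'a \<Rightarrow> 't::real_tree \<Rightarrow> 't" and p :: 't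
  assumes finite_X: "finite X" and card_X: "2 \<le> card X" and cv: "cv G act"
begin

lemma act_one [simp]: "act \<one> x = x"
proof -
  interpret group_action G UNIV act using cv by (simp add: cv_def)
  show ?thesis using id_eq_one by (metis restrict_apply UNIV_I)
qed

lemma act_mult: "g \<in> carrier G \<Longrightarrow> h \<in> carrier G \<Longrightarrow> act (g \<otimes> h) x = act g (act h x)"
proof -
  assume *: "g \<in> carrier G" "h \<in> carrier G"
  interpret group_action G UNIV act using cv by (simp add: cv_def)
  show ?thesis using composition_rule[of x g h] * by simp
qed

lemma act_dist [simp]: "g \<in> carrier G \<Longrightarrow> dist (act g x) (act g y) = dist x y"
  using cv by (simp add: cv_def)

lemma act_free: "g \<in> carrier G \<Longrightarrow> act g x = x \<Longrightarrow> g = \<one>"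
  using cv unfolding cv_def by blast

lemma act_inv_act [simp]: "g \<in> carrier G \<Longrightarrow> act (inv g) (act g x) = x"
  using act_mult[of "inv g" g x] by simp

lemma act_act_inv [simp]: "g \<in> carrier G \<Longrightarrow> act g (act (inv g) x) = x"
  using act_mult[of g "inv g" x] by simp

lemma act_inj:
  assumes "g \<in> carrier G" "h \<in> carrier G" "act g x = act h x"
  shows "g = h"
proof -
  have "act (inv h \<otimes> g) x = x" using assms by (simp add: act_mult)
  then have "inv h \<otimes> g = \<one>" using assms by (intro act_free) auto
  then show ?thesis using assms by (metis inv_closed inv_equality inv_inv)
qed

lemma act_seg_iff [simp]: "g \<in> carrier G \<Longrightarrow> act g z \<in> seg (act g x) (act g y) \<longleftrightarrow> z \<in> seg x y"
  by (simp add: mem_seg_iff)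

lemma act_vertex: "g \<in> carrier G \<Longrightarrow> tree_vertex x \<Longrightarrow> tree_vertex (act g x)"
  unfolding tree_vertex_def
proof (elim exE conjE)
  fix a b c
  assume g: "g \<in> carrier G" and abc: "a \<noteq> x" "b \<noteq> x" "c \<noteq> x" "x \<in> seg a b" "x \<in> seg b c" "x \<in> seg a c"
  have "act g y \<noteq> act g x" if "y \<noteq> x" for y using act_dist[OF g, of y x] that by force
  then show "\<exists>a b c. a \<noteq> act g x \<and> b \<noteq> act g x \<and> c \<noteq> act g x \<and> act g x \<in> seg a b \<and>
      act g x \<in> seg b c \<and> act g x \<in> seg a c"
    using abc g by (intro exI[of _ "act g a"] exI[of _ "act g b"] exI[of _ "act g c"]) simp
qed

definition pt :: "'a \<Rightarrow> 't" where
  "pt g = act g p"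

lemma pt_one [simp]: "pt \<one> = p" by (simp add: pt_def)

lemma act_pt: "g \<in> carrier G \<Longrightarrow> h \<in> carrier G \<Longrightarrow> act g (pt h) = pt (g \<otimes> h)"
  by (simp add: pt_def act_mult)

lemma dist_pt: 
  assumes "g \<in> carrier G" "h \<in> carrier G"
  shows "dist (pt g) (pt h) = dist p (pt (inv g \<otimes> h))"
  using act_dist[of "inv g" "pt g" "pt h"] assms by (simp add: act_pt)

text \<open>A bound for the displacement of \<open>p\<close> under the basis elements; the summand one makes it positive.\<close>

definition jump_bound :: real where
  "jump_bound = 1 + (\<Sum>x\<in>X. dist p (pt x))"

lemma jump_bound_pos: "0 < jump_bound"
  unfolding jump_bound_def by (simp add: add_pos_nonneg sum_nonneg)

lemma dist_basis_le: "x \<in> X \<Longrightarrow> dist p (pt x) \<le> jump_bound"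
  unfolding jump_bound_def using member_le_sum[of x X "\<lambda>x. dist p (pt x)"] finite_X by simp

lemma dist_letter_le: "snd l \<in> X \<Longrightarrow> dist p (pt (letter_value l)) \<le> jump_bound"
  using dist_basis_le[of "snd l"] dist_pt[of "snd l" \<one>] X_sub
  by (auto simp: letter_value_def dist_commute subset_iff)

lemma dist_pt_mult_letter:
  assumes "g \<in> carrier G" "snd l \<in> X"
  shows "dist (pt g) (pt (g \<otimes> letter_value l)) \<le> jump_bound"
  using dist_letter_le[OF assms(2)] act_dist[of g p "pt (letter_value l)"] assms
  by (simp add: act_pt pt_def[symmetric])

lemma dist_word_value_le: "w \<in> words \<Longrightarrow> dist p (pt (word_value G w)) \<le> jump_bound * length w"
proof (induction w)
  case (Cons l w)
  have "dist (pt (letter_value l)) (pt (letter_value l \<otimes> word_value G w)) = dist p (pt (word_value G w))"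
    using Cons.prems act_dist[of "letter_value l" p "pt (word_value G w)"]
    by (simp add: act_pt pt_def[symmetric])
  then show ?case
    using Cons dist_letter_le[of l]
      dist_triangle[of p "pt (letter_value l \<otimes> word_value G w)" "pt (letter_value l)"]
    by (simp add: algebra_simps)
qed simp

lemma dist_pt_le_wlen: "g \<in> carrier G \<Longrightarrow> dist p (pt g) \<le> jump_bound * wlen g"
  using dist_word_value_le[of "reduced_form g"] reduced_form[of g] wlen_reduced_form[of g] by simp

text \<open>The union of the segments joining the orbit points of adjacent elements of the Cayley tree is
  an invariant subtree, hence everything.\<close>

lemma cover_by_segments:
  obtains g x where "g \<in> carrier G" "x \<in> X" "z \<in> seg (pt g) (pt (g \<otimes> x))"
proof -
  define S where "S = {z. \<exists>g\<in>carrier G. \<exists>x\<in>X. z \<in> seg (pt g) (pt (g \<otimes> x))}"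
  have adj: "seg (pt g) (pt (g \<otimes> letter_value l)) \<subseteq> S" if "g \<in> carrier G" "snd l \<in> X" for g l
  proof (cases "fst l")
    case True
    then show ?thesis using that by (auto simp: S_def letter_value_def)
  next
    case False
    have x: "snd l \<in> carrier G" using that X_sub by auto
    have "g \<otimes> inv (snd l) \<otimes> snd l = g" using that x by (simp add: m_assoc)
    then have "seg (pt (g \<otimes> inv (snd l))) (pt g) \<subseteq> S"
      using that x unfolding S_def by (metis (mono_tags, lifting) inv_closed m_closed mem_Collect_eq subsetI)
    then show ?thesis using False by (simp add: letter_value_def seg_commute)
  qed
  have orb: "seg (pt g) (pt (g \<otimes> word_value G w)) \<subseteq> S" if "g \<in> carrier G" "w \<in> words" "w \<noteq> []" for g w
    using that
  proof (induction w arbitrary: g)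
    case (Cons l w)
    let ?h = "g \<otimes> letter_value l"
    have h: "?h \<in> carrier G" using Cons.prems by simp
    have a: "seg (pt g) (pt ?h) \<subseteq> S" using adj Cons.prems by simp
    show ?case
    proof (cases "w = []")
      case True
      then show ?thesis using a Cons.prems by simp
    next
      case False
      have "seg (pt ?h) (pt (?h \<otimes> word_value G w)) \<subseteq> S"
        using Cons.IH[OF h] Cons.prems False by simp
      moreover have "?h \<otimes> word_value G w = g \<otimes> word_value G (l # w)"
        using Cons.prems by (simp add: m_assoc)
      ultimately show ?thesis using a seg_subset_Un[of "pt g" _ "pt ?h"] by fastforce
    qed
  qed simp
  obtain x0 where x0: "x0 \<in> X" using card_X by fastforce
  have pt_S: "pt g \<in> S" if "g \<in> carrier G" for g
    using that x0 mem_seg_endpoints(1) by (auto simp: S_def)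
  have orbit: "seg (pt g) (pt h) \<subseteq> S" if "g \<in> carrier G" "h \<in> carrier G" for g h
  proof (cases "g = h")
    case True
    then have "seg (pt g) (pt h) = {pt g}" by (auto simp: mem_seg_iff dist_commute)
    then show ?thesis using pt_S that by simp
  next
    case False
    let ?w = "reduced_form (inv g \<otimes> h)"
    have w: "?w \<in> words" "word_value G ?w = inv g \<otimes> h" using reduced_form that by auto
    have gh: "g \<otimes> (inv g \<otimes> h) = h" using that by (simp flip: m_assoc)
    have "?w \<noteq> []"
    proof
      assume "?w = []"
      then have "inv g \<otimes> h = \<one>" using w(2) by simp
      then show False using gh False that by simp
    qed
    then show ?thesis using orb[OF that(1) w(1)] w(2) gh by simp
  qed
  have "subtree S"
    unfolding subtree_def
  proof (intro conjI ballI)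
    show "S \<noteq> {}" using pt_S by blast
    fix u w assume "u \<in> S" "w \<in> S"
    then obtain g x h y where u: "g \<in> carrier G" "x \<in> X" "u \<in> seg (pt g) (pt (g \<otimes> x))"
      and w: "h \<in> carrier G" "y \<in> X" "w \<in> seg (pt h) (pt (h \<otimes> y))"
      unfolding S_def by blast
    have "seg u (pt g) \<subseteq> S" "seg (pt h) w \<subseteq> S"
      using u w sub_seg(1)[OF u(3)] sub_seg(1)[OF w(3)] unfolding S_def by (auto simp: seg_commute)
    then show "seg u w \<subseteq> S"
      using seg_subset_Un[of u w "pt g"] seg_subset_Un[of "pt g" w "pt h"] orbit[OF u(1) w(1)] by blast
  qed
  moreover have "act g ` S \<subseteq> S" if g: "g \<in> carrier G" for g
  proof
    fix z assume "z \<in> act g ` S"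
    then obtain h x z' where "h \<in> carrier G" "x \<in> X" "z' \<in> seg (pt h) (pt (h \<otimes> x))" "z = act g z'"
      unfolding S_def by blast
    moreover from this have "z \<in> seg (pt (g \<otimes> h)) (pt (g \<otimes> h \<otimes> x))"
      using g X_sub act_seg_iff[of g z' "pt h" "pt (h \<otimes> x)"] by (simp add: act_pt m_assoc subset_iff)
    ultimately show "z \<in> S" unfolding S_def using g by blast
  qed
  moreover have "\<forall>S. subtree S \<and> (\<forall>g\<in>carrier G. act g ` S \<subseteq> S) \<longrightarrow> S = UNIV"
    using cv unfolding cv_def by (elim conjE)
  ultimately have "S = UNIV" by blast
  then show ?thesis using that unfolding S_def by blast
qed

lemma ex_near_pt:
  obtains g where "g \<in> carrier G" "dist z (pt g) \<le> jump_bound"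
proof -
  obtain g x where gx: "g \<in> carrier G" "x \<in> X" "z \<in> seg (pt g) (pt (g \<otimes> x))"
    by (rule cover_by_segments)
  have "dist (pt g) z \<le> dist (pt g) (pt (g \<otimes> x))"
    using gx(3) unfolding mem_seg_iff by (metis zero_le_dist le_add_same_cancel1)
  also have "\<dots> \<le> jump_bound" using dist_pt_mult_letter[of g "(True, x)"] gx by (simp add: letter_value_def)
  finally show ?thesis using that gx(1) by (simp add: dist_commute)
qed

text \<open>A compact set whose translates cover the tree.\<close>

definition fund_set :: "'t set" where
  "fund_set = (\<Union>x\<in>X. seg p (pt x))"

lemma compact_fund_set: "compact fund_set"
  unfolding fund_set_def using finite_X compact_seg by blast

lemma cover_by_fund_set:
  obtains g k where "g \<in> carrier G" "k \<in> fund_set" "z = act g k"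
proof -
  obtain g x where gx: "g \<in> carrier G" "x \<in> X" "z \<in> seg (pt g) (pt (g \<otimes> x))"
    by (rule cover_by_segments)
  have "x \<in> carrier G" using gx X_sub by blast
  then have "act (inv g) z \<in> seg p (pt x)"
    using gx act_seg_iff[of g "act (inv g) z" p "pt x"] by (simp add: act_pt pt_def[symmetric])
  then have "act (inv g) z \<in> fund_set" using gx by (auto simp: fund_set_def)
  then show ?thesis using that[of g "act (inv g) z"] gx by simp
qed

lemma orbit_gap:
  "\<exists>\<delta>>0. \<forall>g\<in>carrier G. \<forall>h\<in>carrier G. dist (act g z) (act h z) < \<delta> \<longrightarrow> g = h"
proof -
  have "discrete (orbit G act z)" using cv unfolding cv_def by blast
  moreover have "z \<in> orbit G act z" unfolding orbit_def using act_one[of z, symmetric] by blast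
  ultimately have "z isolated_in orbit G act z" by (rule discreteD)
  then obtain T where T: "open T" "T \<inter> orbit G act z = {z}" unfolding isolated_in_def by blast
  then have "z \<in> T" by blast
  with T(1) obtain \<delta> where d: "0 < \<delta>" "\<And>y. dist y z < \<delta> \<Longrightarrow> y \<in> T" unfolding open_dist by blast
  have "g = h" if gh: "g \<in> carrier G" "h \<in> carrier G" "dist (act g z) (act h z) < \<delta>" for g h
  proof -
    have "dist (act (inv h \<otimes> g) z) z < \<delta>"
      using gh act_dist[of h "act (inv h) (act g z)" z] by (simp add: act_mult)
    then have "act (inv h \<otimes> g) z \<in> T \<inter> orbit G act z" using d gh by (auto simp: orbit_def)
    then have "act (inv h) (act g z) = z" using T(2) gh by (simp add: act_mult)
    then have "act g z = act h z" using act_act_inv[OF gh(2), of "act g z"] by simp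
    then show ?thesis using act_inj gh by blast
  qed
  with d(1) show ?thesis by blast
qed

text \<open>If \<open>k\<close> is close to \<open>a\<close> and \<open>k'\<close> is close to \<open>b\<close>, then an element that brings \<open>k'\<close> close to
  \<open>k\<close> brings \<open>b\<close> close to \<open>a\<close>, and at most one element does so, since the orbit of \<open>b\<close> has gaps. Finitely
  many pairs \<open>(a, b)\<close> serve all of the compact set of pairs.\<close>

lemma finite_near_fund_set: "\<exists>\<epsilon>>0. finite {g \<in> carrier G. \<exists>k\<in>fund_set. \<exists>k'\<in>fund_set. dist k (act g k') < \<epsilon>}"
proof -
  obtain \<delta> where \<delta>: "\<And>z. 0 < \<delta> z"
    "\<And>z g h. g \<in> carrier G \<Longrightarrow> h \<in> carrier G \<Longrightarrow> dist (act g z) (act h z) < \<delta> z \<Longrightarrow> g = h"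
    using orbit_gap by metis
  define N where "N ab = ball (fst ab) (\<delta> (snd ab) / 8) \<times> ball (snd ab) (\<delta> (snd ab) / 8)" for ab :: "'t \<times> 't"
  have "compact (fund_set \<times> fund_set)" using compact_fund_set by (rule compact_Times[OF compact_fund_set])
  moreover have "\<And>ab. ab \<in> fund_set \<times> fund_set \<Longrightarrow> open (N ab)" by (simp add: N_def open_Times)
  moreover have "fund_set \<times> fund_set \<subseteq> (\<Union>ab\<in>fund_set \<times> fund_set. N ab)"
  proof
    fix ab assume "ab \<in> fund_set \<times> fund_set"
    moreover have "ab \<in> N ab" using \<delta>(1) by (simp add: N_def mem_Times_iff)
    ultimately show "ab \<in> (\<Union>ab\<in>fund_set \<times> fund_set. N ab)" by blast
  qed
  ultimately obtain F where F: "F \<subseteq> fund_set \<times> fund_set" "finite F" "fund_set \<times> fund_set \<subseteq> (\<Union>ab\<in>F. N ab)"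
    by (rule compactE_image)
  define \<epsilon> where "\<epsilon> = Min (insert 1 ((\<lambda>ab. \<delta> (snd ab) / 8) ` F))"
  have "0 < \<epsilon>" using F(2) \<delta>(1) by (simp add: \<epsilon>_def)
  moreover have "\<epsilon> \<le> \<delta> (snd ab) / 8" if "ab \<in> F" for ab
    unfolding \<epsilon>_def by (rule Min_le) (use F(2) that in auto)
  ultimately have \<epsilon>: "0 < \<epsilon>" "\<And>ab. ab \<in> F \<Longrightarrow> \<epsilon> \<le> \<delta> (snd ab) / 8" .
  define H where "H ab = {g \<in> carrier G. dist (fst ab) (act g (snd ab)) < \<delta> (snd ab) / 2}" for ab
  have "g = h" if "g \<in> H ab" "h \<in> H ab" for g h ab
    using that dist_triangle3[of "act g (snd ab)" "act h (snd ab)" "fst ab"]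
    by (intro \<delta>(2)[of g h "snd ab"]) (auto simp: H_def)
  then have "finite (H ab)" for ab
    by (metis finite.emptyI finite.insertI finite_subset insertI1 subsetI ex_in_conv)
  then have "finite (\<Union>ab\<in>F. H ab)" using F(2) by simp
  moreover have "{g \<in> carrier G. \<exists>k\<in>fund_set. \<exists>k'\<in>fund_set. dist k (act g k') < \<epsilon>} \<subseteq> (\<Union>ab\<in>F. H ab)"
  proof safe
    fix g k k' assume g: "g \<in> carrier G" and k: "k \<in> fund_set" "k' \<in> fund_set" "dist k (act g k') < \<epsilon>"
    obtain a b where ab: "(a, b) \<in> F" "dist a k < \<delta> b / 8" "dist b k' < \<delta> b / 8"
      using F(3) k(1,2) by (force simp: N_def)
    have "dist a (act g b) \<le> dist a k + dist k (act g k') + dist (act g k') (act g b)"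
      using dist_triangle[of a "act g b" k] dist_triangle[of k "act g b" "act g k'"] by linarith
    then have "dist a (act g b) < \<delta> b / 2"
      using ab(2,3) k(3) \<epsilon>(2)[OF ab(1)] g \<delta>(1)[of b] by (simp add: dist_commute)
    then have "g \<in> H (a, b)" using g by (simp add: H_def)
    then show "g \<in> (\<Union>ab\<in>F. H ab)" using ab(1) by blast
  qed
  ultimately show ?thesis using \<epsilon>(1) finite_subset by blast
qed

text \<open>A segment of length less than \<open>Suc (Suc n) * \<epsilon>\<close> is cut after a
  piece shorter than \<open>\<epsilon>\<close>, so that the rest is shorter than \<open>Suc n * \<epsilon>\<close>. This leaves finitely many choices for the
  translate of \<open>fund_set\<close> at the cut, and the induction hypothesis treats the rest.\<close>

lemma finite_orbit_ball: "finite {g \<in> carrier G. dist p (pt g) \<le> M}"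
proof -
  obtain \<epsilon> where \<epsilon>: "0 < \<epsilon>" and fin: "finite {g \<in> carrier G. \<exists>k\<in>fund_set. \<exists>k'\<in>fund_set. dist k (act g k') < \<epsilon>}"
    using finite_near_fund_set by blast
  define E where "E = {g \<in> carrier G. \<exists>k\<in>fund_set. \<exists>k'\<in>fund_set. dist k (act g k') < \<epsilon>}"
  define B where "B n = {g \<in> carrier G. \<exists>k\<in>fund_set. \<exists>k'\<in>fund_set. dist k (act g k') < real (Suc n) * \<epsilon>}" for n
  have "finite (B n)" for n
  proof (induction n)
    case 0
    then show ?case using fin by (simp add: B_def)
  next
    case (Suc n)
    have "B (Suc n) \<subseteq> (\<lambda>(h, b). h \<otimes> b) ` (E \<times> B n)"
    proof
      fix g assume "g \<in> B (Suc n)"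
      then obtain k k' where g: "g \<in> carrier G" and k: "k \<in> fund_set" "k' \<in> fund_set"
        "dist k (act g k') < real (Suc (Suc n)) * \<epsilon>" by (auto simp: B_def)
      let ?d = "dist k (act g k')" and ?r = "real (Suc n) * \<epsilon>"
      \<comment> \<open>Any cut strictly between \<open>?d - ?r\<close> and \<open>\<epsilon>\<close> will do; this is the middle, unless it is negative.\<close>
      define t where "t = max 0 ((?d - ?r + \<epsilon>) / 2)"
      have r: "\<epsilon> \<le> ?r" using \<epsilon> by simp
      have d: "?d < ?r + \<epsilon>" using k(3) by (simp add: algebra_simps)
      have "0 \<le> t" "t \<le> ?d" "t < \<epsilon>" "?d - t < ?r"
        using r d \<epsilon> by (simp_all add: t_def max_def field_simps split: if_splits)
      then obtain z where z: "z \<in> seg k (act g k')" "dist k z < \<epsilon>" "dist z (act g k') < ?r"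
        using seg_at_dist[of t k "act g k'"] unfolding mem_seg_iff
        by (metis add_diff_cancel_left')
      obtain h k'' where h: "h \<in> carrier G" "k'' \<in> fund_set" "z = act h k''" by (rule cover_by_fund_set)
      have "h \<in> E" using h z k by (auto simp: E_def)
      moreover have "dist k'' (act (inv h \<otimes> g) k') < ?r"
        using z(3) h g act_dist[of h k'' "act (inv h) (act g k')"] by (simp add: act_mult)
      then have "inv h \<otimes> g \<in> B n" using h k g by (auto simp: B_def)
      moreover have "g = h \<otimes> (inv h \<otimes> g)" using h g by (simp flip: m_assoc)
      ultimately show "g \<in> (\<lambda>(h, b). h \<otimes> b) ` (E \<times> B n)" by force
    qed
    then show ?case using Suc fin finite_subset by (fastforce simp: E_def)
  qed
  moreover obtain n where "M < real n * \<epsilon>" using \<epsilon> reals_Archimedean3 by blast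
  moreover have "p \<in> fund_set" 
  proof -
    obtain x where "x \<in> X" using card_X by fastforce
    then show ?thesis using mem_seg_endpoints(1) by (auto simp: fund_set_def)
  qed
  ultimately have "{g \<in> carrier G. dist p (pt g) \<le> M} \<subseteq> B n"
    using \<epsilon> by (auto simp: B_def pt_def algebra_simps intro!: bexI[of _ p])
  then show ?thesis using \<open>finite (B n)\<close> finite_subset by blast
qed

lemma countable_carrier: "countable (carrier G)"
proof -
  have "carrier G \<subseteq> (\<Union>n::nat. {g \<in> carrier G. dist p (pt g) \<le> real n})"
    using real_arch_simple by blast
  then show ?thesis
    using finite_orbit_ball by (meson countable_UN countable_finite countable_subset countableI_type)
qed

section \<open>Vertices of the tree\<close>

text \<open>Otherwise the group acts freely by translations of an interval, and two basis elements commute.\<close>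

lemma ex_vertex: "\<exists>v::'t. tree_vertex v"
proof (rule ccontr)
  assume "\<not> ?thesis"
  then obtain \<phi> :: "'t \<Rightarrow> real" where \<phi>: "\<And>z w. \<bar>\<phi> z - \<phi> w\<bar> = dist z w"
    using embedding_of_no_vertex by blast
  have translation: "\<phi> (act g z) - \<phi> z = \<phi> (act g w) - \<phi> w" if "g \<in> carrier G" for g z w
  proof (cases "g = \<one>")
    case False
    then show ?thesis
      using translation_of_no_fixpoint[OF \<phi>, of "act g"] that act_free by auto
  qed simp
  obtain x y where xy: "x \<in> X" "y \<in> X" "x \<noteq> y" using card_X
    by (metis One_nat_def card_le_Suc0_iff_eq finite_X not_less_eq_eq numeral_2_eq_2)
  then have c: "x \<in> carrier G" "y \<in> carrier G" using X_sub by auto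
  have "\<phi> (act (x \<otimes> y) p) = \<phi> (act (y \<otimes> x) p)"
    using translation[OF c(1), of "act y p" p] translation[OF c(2), of "act x p" p] c
    by (simp add: act_mult)
  then have "act (x \<otimes> y) p = act (y \<otimes> x) p" using \<phi>[of "act (x \<otimes> y) p" "act (y \<otimes> x) p"] by simp
  then have "x \<otimes> y = y \<otimes> x" using c by (intro act_inj[of _ _ p]) auto
  then show False using basis_not_commute xy by blast
qed

lemma vertices_cobounded: "\<exists>D. \<forall>x::'t. \<exists>v. tree_vertex v \<and> dist x v \<le> D"
proof -
  obtain v :: 't where v: "tree_vertex v" using ex_vertex by blast
  have "\<exists>w. tree_vertex w \<and> dist x w \<le> jump_bound + dist p v" for x :: 't
  proof -
    obtain g where g: "g \<in> carrier G" "dist x (pt g) \<le> jump_bound" by (rule ex_near_pt)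
    have "dist x (act g v) \<le> jump_bound + dist p v"
      using dist_triangle[of x "act g v" "pt g"] g by (simp add: pt_def)
    then show ?thesis using act_vertex[OF g(1) v] by blast
  qed
  then show ?thesis by blast
qed

text \<open>The third direction at a vertex on \<open>seg a b\<close> contains an orbit point not far away, and
  the vertex is the median of \<open>a\<close>, \<open>b\<close> and that orbit point.\<close>

lemma finite_vertices_seg:
  fixes a b :: 't
  shows "finite {w \<in> seg a b. tree_vertex w}"
proof -
  let ?F = "{g \<in> carrier G. dist p (pt g) \<le> dist p a + dist a b + 1 + jump_bound}"
  have "{w \<in> seg a b. tree_vertex w} \<subseteq> (\<lambda>g. median (pt g) a b) ` ?F"
  proof safe
    fix w assume w: "w \<in> seg a b" "tree_vertex w"
    obtain c where c: "c \<noteq> w" "w \<in> seg c a" "w \<in> seg c b" using branch_off[OF w(2)] by blast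
    \<comment> \<open>Moving the witness of the direction close to \<open>w\<close> bounds the distance of the orbit point.\<close>
    obtain e where e: "e \<in> seg w c" "dist w e = min 1 (dist w c)"
      using seg_at_dist[of "min 1 (dist w c)" w c] by auto
    have e0: "0 < dist w e" "dist w e \<le> 1" using e(2) c(1) by auto
    have "tprod w c e = dist w e" using e(1) tprod_eq_dist_iff[of w e c] by (simp add: tprod_commute)
    then have we: "w \<in> seg e a" "w \<in> seg e b" using same_direction[of w c e] c e0 by auto
    obtain g x where gx: "g \<in> carrier G" "x \<in> X" "e \<in> seg (pt g) (pt (g \<otimes> x))"
      by (rule cover_by_segments)
    have gL: "dist (pt g) (pt (g \<otimes> x)) \<le> jump_bound"
      using dist_pt_mult_letter[of g "(True, x)"] gx by (simp add: letter_value_def)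
    have near: "dist e (pt g) \<le> jump_bound" "dist e (pt (g \<otimes> x)) \<le> jump_bound"
      using gx(3) gL zero_le_dist[of e "pt (g \<otimes> x)"] zero_le_dist[of e "pt g"] dist_commute[of e "pt g"]
      unfolding mem_seg_iff by linarith+
    have "w \<noteq> e" using e0 by auto
    then obtain h where h: "h \<in> carrier G" "0 < tprod w e (pt h)" "dist e (pt h) \<le> jump_bound"
      using direction_endpoint[OF gx(3), of w] near gx(1,2) X_sub by blast
    have "w \<in> seg (pt h) a" "w \<in> seg (pt h) b" using same_direction[OF h(2)] we by auto
    then have "w = median (pt h) a b" using median_unique w(1) by blast
    moreover have "dist p (pt h) \<le> dist p a + dist a b + 1 + jump_bound"
      using dist_triangle[of p "pt h" a] dist_triangle[of a "pt h" w] dist_triangle[of w "pt h" e]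
        w(1) e0(2) h(3) zero_le_dist[of w b] unfolding mem_seg_iff by linarith
    ultimately show "w \<in> (\<lambda>g. median (pt g) a b) ` ?F" using h(1) by blast
  qed
  then show ?thesis using finite_orbit_ball finite_subset by blast
qed

lemma countable_vertices: "countable {w::'t. tree_vertex w}"
proof -
  have "{w::'t. tree_vertex w} \<subseteq> (\<Union>g\<in>carrier G. \<Union>x\<in>X. {w \<in> seg (pt g) (pt (g \<otimes> x)). tree_vertex w})"
  proof
    fix w :: 't assume "w \<in> {w. tree_vertex w}"
    moreover obtain g x where "g \<in> carrier G" "x \<in> X" "w \<in> seg (pt g) (pt (g \<otimes> x))"
      by (rule cover_by_segments)
    ultimately show "w \<in> (\<Union>g\<in>carrier G. \<Union>x\<in>X. {w \<in> seg (pt g) (pt (g \<otimes> x)). tree_vertex w})"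
      by blast
  qed
  moreover have "countable \<dots>"
    by (intro countable_UN countable_carrier countable_finite[OF finite_X]
        countable_finite[OF finite_vertices_seg])
  ultimately show ?thesis by (rule countable_subset)
qed


section \<open>The boundary of the group and the ends of the tree\<close>

lemma wlen_take_reduced:
  assumes "w \<in> words" "reduced_word w" "n \<le> length w"
  shows "take n w \<in> words" "wlen (word_value G (take n w)) = n"
proof -
  show "take n w \<in> words" using assms(1) words_simps(3)[of "take n w" "drop n w"] by simp
  moreover have "reduced_word (take n w)"
    using assms(2) successively_append_iff[of _ "take n w" "drop n w"] by (auto simp: reduced_word_def)
  ultimately show "wlen (word_value G (take n w)) = n"
    using word_length_reduced assms(3) by simp
qed

text \<open>The ultrametric inequality along the prefixes of \<open>w\<close> that are at least \<open>n\<close> long: consecutive ones have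
  orbit points at distance at most \<open>jump_bound\<close>, both far from \<open>p\<close>.\<close>

lemma tprod_prefix_ge:
  assumes far: "\<And>g. g \<in> carrier G \<Longrightarrow> n0 \<le> wlen g \<Longrightarrow> M + jump_bound \<le> dist p (pt g)"
    and w: "w \<in> words" "reduced_word w" and n: "n0 \<le> n" "n \<le> length w"
  shows "M \<le> tprod p (pt (word_value G (take n w))) (pt (word_value G w))"
  using n(2,1)
proof (induction n rule: inc_induct)
  case base
  have "M + jump_bound \<le> dist p (pt (word_value G w))"
    using far[of "word_value G w"] word_length_reduced[OF w] w(1) base by simp
  then show ?case using jump_bound_pos by (simp add: gromov_product_def)
next
  case (step n)
  let ?g = "word_value G (take n w)"
  have tk: "take n w \<in> words" "wlen ?g = n" using wlen_take_reduced[OF w] step.hyps by auto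
  have l: "snd (w ! n) \<in> X" using w(1) step.hyps by (simp add: words_def in_lists_conv_set mem_Times_iff)
  have "word_value G (take (Suc n) w) = ?g \<otimes> letter_value (w ! n)"
    using step.hyps tk l by (simp add: take_Suc_conv_app_nth)
  then have "dist (pt ?g) (pt (word_value G (take (Suc n) w))) \<le> jump_bound"
    using dist_pt_mult_letter[OF _ l, of ?g] tk by simp
  moreover have "M + jump_bound \<le> dist p (pt ?g)" using far[of ?g] tk step.prems by simp
  ultimately have "M \<le> tprod p (pt ?g) (pt (word_value G (take (Suc n) w)))"
    using tprod_ge[of p "pt ?g" "pt (word_value G (take (Suc n) w))"] by linarith
  then show ?case using tprod_ultrametric_ge step.IH step.prems by force
qed

text \<open>The Cayley geodesic between two elements with a long common prefix stays far from the
  identity, hence its orbit points stay far from \<open>p\<close>; as consecutive ones are close, the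
  ultrametric inequality applies along the path.\<close>

lemma tprod_large_of_wprod_large:
  "\<exists>r. \<forall>g\<in>carrier G. \<forall>h\<in>carrier G. r \<le> wprod g h \<longrightarrow> M \<le> tprod p (pt g) (pt h)"
proof -
  let ?F = "{g \<in> carrier G. dist p (pt g) \<le> M + jump_bound}"
  \<comment> \<open>Longer than every word in the finite set \<open>?F\<close>.\<close>
  define n0 where "n0 = Suc (\<Sum>g\<in>?F. wlen g)"
  have far: "M + jump_bound \<le> dist p (pt g)" if "g \<in> carrier G" "n0 \<le> wlen g" for g
    using that member_le_sum[of g ?F wlen] finite_orbit_ball[of "M + jump_bound"] by (force simp: n0_def)
  have "M \<le> tprod p (pt g) (pt h)"
    if gh: "g \<in> carrier G" "h \<in> carrier G" and le: "real n0 \<le> wprod g h" for g h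
  proof -
    let ?u = "reduced_form g" and ?v = "reduced_form h"
    have le': "n0 \<le> lcp_length ?u ?v" using le gh by (simp add: wprod_eq_lcp_length)
    then have n: "n0 \<le> length ?u" "n0 \<le> length ?v" "take n0 ?u = take n0 ?v"
      using lcp_length_le[of ?u ?v] lcp_length_take by auto
    have "M \<le> tprod p (pt (word_value G (take n0 ?u))) (pt g)"
      using tprod_prefix_ge[OF far, where w = ?u and n = n0] reduced_form[OF gh(1)] n by simp
    moreover have "M \<le> tprod p (pt (word_value G (take n0 ?u))) (pt h)"
      using tprod_prefix_ge[OF far, where w = ?v and n = n0] reduced_form[OF gh(2)] n by simp
    ultimately show ?thesis using tprod_ultrametric_ge tprod_commute by metis
  qed
  then show ?thesis by blast
qed

text \<open>Conversely, a tree geodesic far from \<open>p\<close> is followed by group elements in steps of length one;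
  these have long words, and consecutive ones differ by an element of a finite set.\<close>

lemma wprod_large_of_tprod_large:
  "\<exists>r. \<forall>g\<in>carrier G. \<forall>h\<in>carrier G. r \<le> tprod p (pt g) (pt h) \<longrightarrow> M \<le> wprod g h"
proof -
  let ?F = "{g \<in> carrier G. dist p (pt g) \<le> 2 * jump_bound + 1}"
  define m where "m = (\<Sum>g\<in>?F. wlen g)"
  have m: "wlen g \<le> m" if "g \<in> carrier G" "dist p (pt g) \<le> 2 * jump_bound + 1" for g
    using that member_le_sum[of g ?F wlen] finite_orbit_ball by (force simp: m_def)
  \<comment> \<open>The first summand pays for the distance to the nearest orbit point. In the rest, \<open>m\<close> pays for the
    length of the quotient of two consecutive elements.\<close>
  define r where "r = jump_bound + jump_bound * (\<bar>M\<bar> + real m)"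
  have long: "\<bar>M\<bar> + real m \<le> wlen g" if "g \<in> carrier G" "r \<le> dist p a" "dist a (pt g) \<le> jump_bound" for g a
  proof -
    have "r - jump_bound \<le> jump_bound * wlen g"
      using that dist_pt_le_wlen[of g] dist_triangle2[of p a "pt g"] by (simp add: dist_commute)
    then have "jump_bound * (\<bar>M\<bar> + real m) \<le> jump_bound * wlen g" by (simp add: r_def)
    then show ?thesis using jump_bound_pos by simp
  qed
  have chain: "M \<le> wprod g h"
    if "g \<in> carrier G" "h \<in> carrier G" "dist a (pt g) \<le> jump_bound" "dist b (pt h) \<le> jump_bound"
      "\<forall>z\<in>seg a b. r \<le> dist p z" "dist a b \<le> real n + 1" for a b g h n
    using that
  proof (induction n arbitrary: a b g h)
    case 0
    have "dist (pt g) (pt h) \<le> 2 * jump_bound + 1"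
      using 0 dist_triangle[of "pt g" "pt h" a] dist_triangle[of a "pt h" b]
      by (simp add: dist_commute)
    then have "wlen (inv g \<otimes> h) \<le> m" using 0 m dist_pt by simp
    moreover have "\<bar>M\<bar> + real m \<le> wlen g" "\<bar>M\<bar> + real m \<le> wlen h"
      using 0 long[of g a] long[of h b] mem_seg_endpoints by blast+
    ultimately show ?case using 0 abs_ge_self[of M] by (simp add: wprod_eq_wlen field_simps)
  next
    case (Suc n)
    show ?case
    proof (cases "dist a b \<le> 1")
      case True
      then show ?thesis using Suc.IH[of g h a b] Suc.prems by simp
    next
      case False
      then obtain z where z: "z \<in> seg a b" "dist a z = 1" using seg_at_dist[of 1 a b] by auto
      obtain k where k: "k \<in> carrier G" "dist z (pt k) \<le> jump_bound" by (rule ex_near_pt)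
      have "dist z b \<le> real n + 1" using z Suc.prems(6) unfolding mem_seg_iff by simp
      then have "M \<le> wprod k h" using Suc.IH[of k h z b] Suc.prems k sub_seg[OF z(1)] by blast
      moreover have "M \<le> wprod g k"
        using Suc.IH[of g k a z] Suc.prems k sub_seg[OF z(1)] z(2) by auto
      ultimately show ?thesis using wprod_ultrametric_ge Suc.prems k by blast
    qed
  qed
  have "M \<le> wprod g h"
    if gh: "g \<in> carrier G" "h \<in> carrier G" and le: "r \<le> tprod p (pt g) (pt h)" for g h
  proof -
    obtain n where "dist (pt g) (pt h) \<le> real n" using real_arch_simple by blast
    moreover have "\<forall>z\<in>seg (pt g) (pt h). r \<le> dist p z" using tprod_le_dist_seg le order_trans by blast
    ultimately show ?thesis using chain[OF gh, of "pt g" "pt h" n] jump_bound_pos by simp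
  qed
  then show ?thesis by blast
qed

definition orbit_seq :: "(nat \<Rightarrow> 'a) \<Rightarrow> nat \<Rightarrow> 't" where
  "orbit_seq u = (\<lambda>n. pt (u n))"

text \<open>The orbit map identifies convergence to infinity in the group with convergence to an end of the tree, so
  a boundary point is the class of all sequences whose orbit points converge to one end.\<close>

lemma wprod_tendsto_iff_asymptotic:
  assumes "range u \<subseteq> carrier G" "range w \<subseteq> carrier G"
  shows "(\<forall>M. \<exists>N. \<forall>i\<ge>N. \<forall>j\<ge>N. M \<le> wprod (u i) (w j)) \<longleftrightarrow> asymptotic (orbit_seq u) (orbit_seq w)"
    (is "?A \<longleftrightarrow> ?B")
proof
  have c: "u i \<in> carrier G" "w i \<in> carrier G" for i using assms by auto
  { assume A: ?A
    show ?B unfolding asymptotic_iff[of _ _ p]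
    proof
      fix M
      obtain r where r: "\<forall>g\<in>carrier G. \<forall>h\<in>carrier G. r \<le> wprod g h \<longrightarrow> M \<le> tprod p (pt g) (pt h)"
        using tprod_large_of_wprod_large by blast
      obtain N where "\<forall>i\<ge>N. \<forall>j\<ge>N. r \<le> wprod (u i) (w j)" using A by blast
      then show "\<exists>N. \<forall>i\<ge>N. \<forall>j\<ge>N. M \<le> tprod p (orbit_seq u i) (orbit_seq w j)" using r c unfolding orbit_seq_def by blast
    qed
  next
    assume B: ?B
    show ?A
    proof
      fix M
      obtain r where r: "\<forall>g\<in>carrier G. \<forall>h\<in>carrier G. r \<le> tprod p (pt g) (pt h) \<longrightarrow> M \<le> wprod g h"
        using wprod_large_of_tprod_large by blast
      obtain N where "\<forall>i\<ge>N. \<forall>j\<ge>N. r \<le> tprod p (orbit_seq u i) (orbit_seq w j)" using asymptoticD[OF B] by blast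
      then show "\<exists>N. \<forall>i\<ge>N. \<forall>j\<ge>N. M \<le> wprod (u i) (w j)" using r c unfolding orbit_seq_def by blast
    qed }
qed

lemma gromov_seq_word_iff: "gromov_seq (carrier G) (word_dist G X) \<one> u \<longleftrightarrow>
    range u \<subseteq> carrier G \<and> asymptotic (orbit_seq u) (orbit_seq u)"
  using wprod_tendsto_iff_asymptotic[of u u] unfolding gromov_seq_iff by blast

lemma gromov_equiv_word_iff: "gromov_equiv (carrier G) (word_dist G X) \<one> u w \<longleftrightarrow>
    range u \<subseteq> carrier G \<and> range w \<subseteq> carrier G \<and> asymptotic (orbit_seq u) (orbit_seq w)"
  using wprod_tendsto_iff_asymptotic[of u w] asymptotic_refl asymptotic_sym
  unfolding gromov_equiv_iff gromov_seq_word_iff by blast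

abbreviation group_boundary :: "(nat \<Rightarrow> 'a) set set" where
  "group_boundary \<equiv> gromov_boundary (carrier G) (word_dist G X) \<one>"

definition end_class :: "(nat \<Rightarrow> 'a) \<Rightarrow> (nat \<Rightarrow> 'a) set" where
  "end_class u = {w. range w \<subseteq> carrier G \<and> asymptotic (orbit_seq u) (orbit_seq w)}"

lemma group_boundary_iff: "\<zeta> \<in> group_boundary \<longleftrightarrow>
    (\<exists>u. range u \<subseteq> carrier G \<and> asymptotic (orbit_seq u) (orbit_seq u) \<and> \<zeta> = end_class u)"
  unfolding gromov_boundary_def quotient_def gromov_equiv_word_iff gromov_seq_word_iff end_class_def
  by auto

lemma group_boundary_nonempty: "\<zeta> \<in> group_boundary \<Longrightarrow> \<exists>u. u \<in> \<zeta>"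
  by (auto simp: group_boundary_iff end_class_def)

lemma group_boundaryD:
  assumes "\<zeta> \<in> group_boundary" "u \<in> \<zeta>"
  shows "range u \<subseteq> carrier G" "asymptotic (orbit_seq u) (orbit_seq u)" "\<zeta> = end_class u"
proof -
  obtain v where v: "range v \<subseteq> carrier G" "asymptotic (orbit_seq v) (orbit_seq v)" "\<zeta> = end_class v"
    using assms(1) group_boundary_iff by blast
  with assms(2) have vu: "range u \<subseteq> carrier G" "asymptotic (orbit_seq v) (orbit_seq u)" by (auto simp: end_class_def)
  show "range u \<subseteq> carrier G" by (rule vu)
  show "asymptotic (orbit_seq u) (orbit_seq u)" using vu(2) asymptotic_sym asymptotic_refl by blast
  show "\<zeta> = end_class u"
    unfolding v(3) end_class_def using vu(2) asymptotic_sym asymptotic_trans by blast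
qed

lemma group_boundary_eq_iff:
  assumes "\<zeta> \<in> group_boundary" "\<eta> \<in> group_boundary" "u \<in> \<zeta>" "w \<in> \<eta>"
  shows "\<zeta> = \<eta> \<longleftrightarrow> asymptotic (orbit_seq u) (orbit_seq w)"
proof
  assume "\<zeta> = \<eta>"
  then have "w \<in> end_class u" using assms group_boundaryD(3) by blast
  then show "asymptotic (orbit_seq u) (orbit_seq w)" by (simp add: end_class_def)
next
  assume "asymptotic (orbit_seq u) (orbit_seq w)"
  then have "w \<in> \<zeta>" using group_boundaryD[OF assms(1,3)] group_boundaryD(1)[OF assms(2,4)] by (auto simp: end_class_def)
  then show "\<zeta> = \<eta>" using group_boundaryD(3)[OF assms(1)] group_boundaryD(3)[OF assms(2,4)] by simp
qed

lemma orbit_boundary_map_iff: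
  assumes "\<zeta> \<in> group_boundary" "u \<in> \<zeta>"
  shows "y \<in> orbit_boundary_map act \<zeta> \<longleftrightarrow> asymptotic (orbit_seq u) y"
proof
  assume "y \<in> orbit_boundary_map act \<zeta>"
  then obtain q x where x: "x \<in> \<zeta>" "asymptotic (\<lambda>n. act (x n) q) y"
    unfolding orbit_boundary_map_def gromov_equiv_tree_iff by blast
  note xb = group_boundaryD[OF assms(1) x(1)]
  have "dist (orbit_seq x n) (act (x n) q) \<le> dist p q" for n
    using xb(1) by (simp add: orbit_seq_def pt_def image_subset_iff)
  then have "asymptotic (orbit_seq x) (\<lambda>n. act (x n) q)"
    using asymptotic_bounded_dist[OF xb(2), of "\<lambda>n. act (x n) q" "dist p q"] by blast
  moreover have "asymptotic (orbit_seq u) (orbit_seq x)"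
    using x(1) group_boundaryD(3)[OF assms] by (simp add: end_class_def)
  ultimately show "asymptotic (orbit_seq u) y" using x(2) asymptotic_trans by blast
next
  assume "asymptotic (orbit_seq u) y"
  then show "y \<in> orbit_boundary_map act \<zeta>"
    unfolding orbit_boundary_map_def gromov_equiv_tree_iff orbit_seq_def pt_def using assms(2) by blast
qed

section \<open>Cylinders are open\<close>

lemma topspace_free_boundary: "topspace (free_boundary G X) = group_boundary"
proof -
  have "openin (free_boundary G X) group_boundary"
    unfolding free_boundary_def openin_gromov_topology by (auto simp: gromov_nbhd_def)
  moreover have "A \<subseteq> group_boundary" if "openin (free_boundary G X) A" for A
    using that by (simp add: free_boundary_def openin_gromov_topology)
  ultimately show ?thesis by (metis openin_subset openin_topspace subset_antisym)
qed

lemma topspace_free_boundary2: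
  "topspace (free_boundary2 G X) = {(\<zeta>1, \<zeta>2). \<zeta>1 \<in> group_boundary \<and> \<zeta>2 \<in> group_boundary \<and> \<zeta>1 \<noteq> \<zeta>2}"
  by (auto simp: free_boundary2_def topspace_free_boundary)

text \<open>The boundary points behind \<open>y\<close> as seen from \<open>x\<close>.\<close>

definition shadow :: "'t \<Rightarrow> 't \<Rightarrow> (nat \<Rightarrow> 'a) set set" where
  "shadow x y = {\<zeta> \<in> group_boundary. \<exists>u\<in>\<zeta>. \<exists>N. \<forall>j\<ge>N. y \<in> seg x (orbit_seq u j)}"

lemma eventually_seg_asymptotic:
  assumes "asymptotic U W" "\<And>i. N \<le> i \<Longrightarrow> y \<in> seg x (U i)"
  shows "\<exists>N. \<forall>j\<ge>N. y \<in> seg x (W j)"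
proof -
  obtain N' where N': "\<forall>i\<ge>N'. \<forall>j\<ge>N'. dist x y \<le> tprod x (U i) (W j)"
    using asymptoticD[OF assms(1)] by blast
  have "y \<in> seg x (W j)" if "max N N' \<le> j" for j
    using mem_seg_of_tprod[OF assms(2)[of "max N N'"], of "W j"] N' that by simp
  then show ?thesis by blast
qed

lemma shadow_iff:
  assumes "\<zeta> \<in> group_boundary" "u \<in> \<zeta>"
  shows "\<zeta> \<in> shadow x y \<longleftrightarrow> (\<exists>N. \<forall>j\<ge>N. y \<in> seg x (orbit_seq u j))"
proof
  assume "\<zeta> \<in> shadow x y"
  then obtain v N where v: "v \<in> \<zeta>" "\<And>j. N \<le> j \<Longrightarrow> y \<in> seg x (orbit_seq v j)" by (auto simp: shadow_def)
  have "asymptotic (orbit_seq v) (orbit_seq u)" using group_boundary_eq_iff[OF assms(1) assms(1) v(1) assms(2)] by simp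
  from eventually_seg_asymptotic[OF this v(2)] show "\<exists>N. \<forall>j\<ge>N. y \<in> seg x (orbit_seq u j)" by blast
qed (use assms in \<open>auto simp: shadow_def\<close>)

text \<open>From left to right, follow the line in both directions. From right to left, the rays from \<open>y\<close>
  through \<open>x\<close> and from \<open>x\<close> through \<open>y\<close> overlap in \<open>seg x y\<close> and glue to a line.\<close>

lemma Cyl_iff_shadow:
  assumes "x \<noteq> y"
  shows "Cyl G X act x y = (shadow y x \<times> shadow x y) \<inter> topspace (free_boundary2 G X)"
proof (intro equalityI subsetI)
  fix z assume "z \<in> Cyl G X act x y"
  then obtain \<zeta>1 \<zeta>2 c s t where z: "z = (\<zeta>1, \<zeta>2)" "z \<in> topspace (free_boundary2 G X)"
    and c: "geodesic_line c" "(\<lambda>n. c (- real n)) \<in> orbit_boundary_map act \<zeta>1"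
      "(\<lambda>n. c (real n)) \<in> orbit_boundary_map act \<zeta>2" "s < t" "c s = x" "c t = y"
    unfolding Cyl_def by auto
  have b: "\<zeta>1 \<in> group_boundary" "\<zeta>2 \<in> group_boundary" using z by (auto simp: topspace_free_boundary2)
  then obtain u w where uw: "u \<in> \<zeta>1" "w \<in> \<zeta>2" using group_boundary_nonempty by metis
  have a1: "asymptotic (\<lambda>n. c (- real n)) (orbit_seq u)"
    using c(2) orbit_boundary_map_iff[OF b(1) uw(1)] asymptotic_sym by blast
  have a2: "asymptotic (\<lambda>n. c (real n)) (orbit_seq w)"
    using c(3) orbit_boundary_map_iff[OF b(2) uw(2)] asymptotic_sym by blast
  obtain N1 where "\<And>j. N1 \<le> j \<Longrightarrow> y \<in> seg x (orbit_seq w j)"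
    using line_eventually_through[OF c(1) a2 c(5,6,4)] by blast
  moreover obtain N2 where "\<And>j. N2 \<le> j \<Longrightarrow> x \<in> seg y (orbit_seq u j)"
    using line_eventually_through[OF geodesic_line_reverse[OF c(1)] a1, of "-t" y "-s" x] c(4-6)
    by auto
  ultimately show "z \<in> (shadow y x \<times> shadow x y) \<inter> topspace (free_boundary2 G X)"
    using z uw b unfolding shadow_def by blast
next
  fix z assume "z \<in> (shadow y x \<times> shadow x y) \<inter> topspace (free_boundary2 G X)"
  then obtain \<zeta>1 \<zeta>2 u w N1 N2 where z: "z = (\<zeta>1, \<zeta>2)" "z \<in> topspace (free_boundary2 G X)"
    and b: "\<zeta>1 \<in> group_boundary" "\<zeta>2 \<in> group_boundary" "u \<in> \<zeta>1" "w \<in> \<zeta>2"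
    and N: "\<And>j. N1 \<le> j \<Longrightarrow> x \<in> seg y (orbit_seq u j)" "\<And>j. N2 \<le> j \<Longrightarrow> y \<in> seg x (orbit_seq w j)"
    unfolding shadow_def by blast
  have "x \<in> seg (orbit_seq u i) (orbit_seq w j)" if "max N1 N2 \<le> i" "max N1 N2 \<le> j" for i j
  proof -
    have yj: "y \<in> seg x (orbit_seq w j)" using N(2) that by simp
    have xi: "x \<in> seg y (orbit_seq u i)" using N(1) that by simp
    show ?thesis
      using seg_concat[OF yj xi assms] yj by (simp add: mem_seg_iff)
  qed
  then obtain c where c: "geodesic_line c" "c 0 = x" "asymptotic (orbit_seq u) (\<lambda>n. c (- real n))"
    "asymptotic (orbit_seq w) (\<lambda>n. c (real n))"
    "\<And>y N. (\<And>j. N \<le> j \<Longrightarrow> y \<in> seg x (orbit_seq w j)) \<Longrightarrow> c (dist x y) = y"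
    using ex_line[OF group_boundaryD(2)[OF b(1,3)] group_boundaryD(2)[OF b(2,4)]] by blast
  have "c (dist x y) = y" using c(5) N(2) by blast
  moreover have "0 < dist x y" using assms by simp
  moreover have "(\<lambda>n. c (- real n)) \<in> orbit_boundary_map act \<zeta>1" "(\<lambda>n. c (real n)) \<in> orbit_boundary_map act \<zeta>2"
    using c(3,4) orbit_boundary_map_iff[OF b(1,3)] orbit_boundary_map_iff[OF b(2,4)] by auto
  ultimately show "z \<in> Cyl G X act x y"
    unfolding Cyl_def using z c(1,2) by blast
qed

text \<open>If \<open>y\<close> lies between \<open>x\<close> and the orbit points of a sequence, then it also lies between \<open>x\<close> and every
  orbit point whose Gromov product with these, seen from \<open>x\<close>, is at least \<open>dist x y\<close>.\<close>

lemma openin_shadow: "openin (free_boundary G X) (shadow x y)"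
  unfolding free_boundary_def openin_gromov_topology
proof (intro conjI ballI)
  show "shadow x y \<subseteq> group_boundary" by (auto simp: shadow_def)
  fix \<zeta> assume z: "\<zeta> \<in> shadow x y"
  then have zb: "\<zeta> \<in> group_boundary" by (simp add: shadow_def)
  obtain r where r: "\<forall>g\<in>carrier G. \<forall>h\<in>carrier G. r \<le> wprod g h \<longrightarrow>
      dist x y + dist p x \<le> tprod p (pt g) (pt h)"
    using tprod_large_of_wprod_large by blast
  have "gromov_nbhd (carrier G) (word_dist G X) \<one> \<zeta> r \<subseteq> shadow x y"
  proof
    fix \<eta> assume "\<eta> \<in> gromov_nbhd (carrier G) (word_dist G X) \<one> \<zeta> r"
    then obtain u w N where b: "\<eta> \<in> group_boundary" "u \<in> \<zeta>" "w \<in> \<eta>"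
      and N: "\<forall>i\<ge>N. \<forall>j\<ge>N. r \<le> wprod (u i) (w j)"
      unfolding gromov_nbhd_def eventually_prod_sequentially split_conv by blast
    obtain N' where N': "\<forall>j\<ge>N'. y \<in> seg x (orbit_seq u j)" using z shadow_iff[OF zb b(2)] by blast
    have "y \<in> seg x (orbit_seq w j)" if "max N N' \<le> j" for j
    proof -
      have "u j \<in> carrier G" "w j \<in> carrier G" using group_boundaryD(1)[OF zb b(2)] group_boundaryD(1)[OF b(1,3)] by auto
      then have "dist x y + dist p x \<le> tprod p (orbit_seq u j) (orbit_seq w j)" using r N that by (simp add: orbit_seq_def)
      then have "dist x y \<le> tprod x (orbit_seq u j) (orbit_seq w j)"
        using tprod_basepoint[of p "orbit_seq u j" "orbit_seq w j" x] by linarith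
      then show ?thesis using mem_seg_of_tprod[of y x "orbit_seq u j" "orbit_seq w j"] N' that by simp
    qed
    then show "\<eta> \<in> shadow x y" using shadow_iff[OF b(1,3)] by blast
  qed
  then show "\<exists>r. gromov_nbhd (carrier G) (word_dist G X) \<one> \<zeta> r \<subseteq> shadow x y" by blast
qed

lemma Cyl_in_sets:
  assumes "\<mu> \<in> Curr G X" "x \<noteq> y"
  shows "Cyl G X act x y \<in> sets \<mu>"
proof -
  have "Cyl G X act x y = (shadow y x \<times> shadow x y) \<inter> {(\<zeta>1, \<zeta>2). \<zeta>1 \<noteq> \<zeta>2}"
    unfolding Cyl_iff_shadow[OF assms(2)] topspace_free_boundary2 by (auto simp: shadow_def)
  moreover have "openin (prod_topology (free_boundary G X) (free_boundary G X)) (shadow y x \<times> shadow x y)"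
    by (simp add: openin_prod_Times_iff openin_shadow)
  ultimately have "openin (free_boundary2 G X) (Cyl G X act x y)"
    unfolding free_boundary2_def openin_subtopology by blast
  then show ?thesis using assms(1) unfolding Curr_def by auto
qed

lemma ex_line_between_ends:
  assumes "(\<zeta>1, \<zeta>2) \<in> topspace (free_boundary2 G X)"
  obtains c where "geodesic_line c" "(\<lambda>n. c (- real n)) \<in> orbit_boundary_map act \<zeta>1"
      "(\<lambda>n. c (real n)) \<in> orbit_boundary_map act \<zeta>2"
proof -
  have b: "\<zeta>1 \<in> group_boundary" "\<zeta>2 \<in> group_boundary" "\<zeta>1 \<noteq> \<zeta>2" using assms by (auto simp: topspace_free_boundary2)
  then obtain u w where uw: "u \<in> \<zeta>1" "w \<in> \<zeta>2" using group_boundary_nonempty by metis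
  note a = group_boundaryD(2)[OF b(1) uw(1)] group_boundaryD(2)[OF b(2) uw(2)]
  have "\<not> asymptotic (orbit_seq u) (orbit_seq w)" using group_boundary_eq_iff[OF b(1,2) uw] b(3) by blast
  then obtain N q where q: "\<And>i j. N \<le> i \<Longrightarrow> N \<le> j \<Longrightarrow> q \<in> seg (orbit_seq u i) (orbit_seq w j)"
    using ex_separating_point[OF a] by blast
  show ?thesis
  proof (rule ex_line[OF a q])
    fix c :: "real \<Rightarrow> 't"
    assume "geodesic_line c" "asymptotic (orbit_seq u) (\<lambda>n. c (- real n))"
      "asymptotic (orbit_seq w) (\<lambda>n. c (real n))"
    then show ?thesis
      using that orbit_boundary_map_iff[OF b(1) uw(1)] orbit_boundary_map_iff[OF b(2) uw(2)] by blast
  qed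
qed

lemma CylI:
  assumes "(\<zeta>1, \<zeta>2) \<in> topspace (free_boundary2 G X)" "geodesic_line c"
    "(\<lambda>n. c (- real n)) \<in> orbit_boundary_map act \<zeta>1" "(\<lambda>n. c (real n)) \<in> orbit_boundary_map act \<zeta>2" "s < t"
  shows "(\<zeta>1, \<zeta>2) \<in> Cyl G X act (c s) (c t)"
  using assms unfolding Cyl_def by blast

section \<open>Equivariance of cylinders\<close>

lemma asymptotic_act:
  assumes "g \<in> carrier G"
  shows "asymptotic (\<lambda>n. act g (U n)) (\<lambda>n. act g (W n)) \<longleftrightarrow> asymptotic U W"
proof -
  have "tprod (act g q) (act g x) (act g y) = tprod q x y" for q x y
    using assms by (simp add: gromov_product_def)
  then show ?thesis 
    unfolding asymptotic_iff[of "\<lambda>n. act g (U n)" _ "act g p"] asymptotic_iff[of U W p] by simp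
qed

lemma orbit_seq_mult: "g \<in> carrier G \<Longrightarrow> range u \<subseteq> carrier G \<Longrightarrow> orbit_seq (\<lambda>n. g \<otimes> u n) = (\<lambda>n. act g (orbit_seq u n))"
  by (auto simp: orbit_seq_def act_pt image_subset_iff)

lemma boundary_translate_end_class:
  assumes g: "g \<in> carrier G" and u: "range u \<subseteq> carrier G"
  shows "boundary_translate G g (end_class u) = end_class (\<lambda>n. g \<otimes> u n)"
proof (intro equalityI subsetI)
  fix w assume "w \<in> boundary_translate G g (end_class u)"
  then obtain v where v: "w = (\<lambda>n. g \<otimes> v n)" "range v \<subseteq> carrier G" "asymptotic (orbit_seq u) (orbit_seq v)"
    by (auto simp: boundary_translate_def end_class_def)
  then show "w \<in> end_class (\<lambda>n. g \<otimes> u n)"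
    using g u by (auto simp: end_class_def orbit_seq_mult asymptotic_act image_subset_iff)
next
  fix w assume w: "w \<in> end_class (\<lambda>n. g \<otimes> u n)"
  then have wc: "w n \<in> carrier G" for n by (auto simp: end_class_def)
  define v where "v = (\<lambda>n. inv g \<otimes> w n)"
  have v: "range v \<subseteq> carrier G" "w = (\<lambda>n. g \<otimes> v n)"
    using wc g by (auto simp: v_def simp flip: m_assoc)
  with w have "asymptotic (orbit_seq u) (orbit_seq v)"
    using g u by (simp add: end_class_def orbit_seq_mult asymptotic_act)
  then show "w \<in> boundary_translate G g (end_class u)"
    using v by (auto simp: boundary_translate_def end_class_def)
qed

lemma boundary_translate_in_group_boundary: "g \<in> carrier G \<Longrightarrow> \<zeta> \<in> group_boundary \<Longrightarrow> boundary_translate G g \<zeta> \<in> group_boundary"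
proof -
  assume g: "g \<in> carrier G" and "\<zeta> \<in> group_boundary"
  then obtain u where u: "range u \<subseteq> carrier G" "asymptotic (orbit_seq u) (orbit_seq u)" "\<zeta> = end_class u"
    using group_boundary_iff by blast
  then show ?thesis
    unfolding group_boundary_iff u(3) boundary_translate_end_class[OF g u(1)]
    using g by (intro exI[of _ "\<lambda>n. g \<otimes> u n"]) (auto simp: orbit_seq_mult asymptotic_act)
qed

lemma boundary_translate_inv:
  assumes g: "g \<in> carrier G" and z: "\<zeta> \<in> group_boundary"
  shows "boundary_translate G (inv g) (boundary_translate G g \<zeta>) = \<zeta>"
proof -
  obtain u where u: "range u \<subseteq> carrier G" "\<zeta> = end_class u" using z group_boundary_iff by blast
  have "range (\<lambda>n. g \<otimes> u n) \<subseteq> carrier G" "(\<lambda>n. inv g \<otimes> (g \<otimes> u n)) = u"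
    using u g by (auto simp: image_subset_iff simp flip: m_assoc)
  then show ?thesis using u g by (simp add: boundary_translate_end_class)
qed

lemma shadow_translate:
  assumes g: "g \<in> carrier G" and z: "\<zeta> \<in> shadow x y"
  shows "boundary_translate G g \<zeta> \<in> shadow (act g x) (act g y)"
proof -
  obtain u N where u: "\<zeta> \<in> group_boundary" "u \<in> \<zeta>" "\<forall>j\<ge>N. y \<in> seg x (orbit_seq u j)" using z by (auto simp: shadow_def)
  have "(\<lambda>n. g \<otimes> u n) \<in> boundary_translate G g \<zeta>" using u(2) by (auto simp: boundary_translate_def)
  moreover have "\<forall>j\<ge>N. act g y \<in> seg (act g x) (orbit_seq (\<lambda>n. g \<otimes> u n) j)"
    using u(3) g orbit_seq_mult[OF g group_boundaryD(1)[OF u(1,2)]] by simp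
  ultimately show ?thesis using boundary_translate_in_group_boundary[OF g u(1)] unfolding shadow_def by blast
qed

lemma Cyl_act:
  assumes g: "g \<in> carrier G" and "x \<noteq> y"
  shows "Cyl G X act (act g x) (act g y) =
    map_prod (boundary_translate G g) (boundary_translate G g) ` Cyl G X act x y"
proof -
  have ne: "act g x \<noteq> act g y" if "g \<in> carrier G" "x \<noteq> y" for g x y
    using act_dist[OF that(1), of x y] that(2) by force
  have into: "map_prod (boundary_translate G g) (boundary_translate G g) z \<in> Cyl G X act (act g x) (act g y)"
    if g: "g \<in> carrier G" and xy: "x \<noteq> y" and z: "z \<in> Cyl G X act x y" for g x y z
  proof -
    obtain \<zeta>1 \<zeta>2 where z': "z = (\<zeta>1, \<zeta>2)" "\<zeta>1 \<in> shadow y x" "\<zeta>2 \<in> shadow x y"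
      "\<zeta>1 \<in> group_boundary" "\<zeta>2 \<in> group_boundary" "\<zeta>1 \<noteq> \<zeta>2"
      using z unfolding Cyl_iff_shadow[OF xy] topspace_free_boundary2 by auto
    have "boundary_translate G g \<zeta>1 \<noteq> boundary_translate G g \<zeta>2"
      using boundary_translate_inv[OF g] z'(4-6) by metis
    then show ?thesis
      unfolding Cyl_iff_shadow[OF ne[OF g xy]] topspace_free_boundary2
      using z' shadow_translate[OF g] boundary_translate_in_group_boundary[OF g] by simp
  qed
  show ?thesis
  proof (intro equalityI subsetI)
    fix z assume z: "z \<in> Cyl G X act (act g x) (act g y)"
    let ?z = "map_prod (boundary_translate G (inv g)) (boundary_translate G (inv g)) z"
    have "?z \<in> Cyl G X act x y" using into[OF _ ne[OF assms] z, of "inv g"] g by simp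
    moreover have "fst z \<in> group_boundary" "snd z \<in> group_boundary"
      using z unfolding Cyl_def topspace_free_boundary2 by auto
    then have "z = map_prod (boundary_translate G g) (boundary_translate G g) ?z"
      using boundary_translate_inv[of "inv g"] g by (cases z) simp
    ultimately show "z \<in> map_prod (boundary_translate G g) (boundary_translate G g) ` Cyl G X act x y"
      by blast
  qed (use into[OF assms] in auto)
qed

lemma emeasure_Cyl_act:
  assumes "\<mu> \<in> Curr G X" "g \<in> carrier G" "x \<noteq> y"
  shows "emeasure \<mu> (Cyl G X act (act g x) (act g y)) = emeasure \<mu> (Cyl G X act x y)"
proof -
  have "\<forall>g\<in>carrier G. \<forall>A\<in>sets \<mu>.
      emeasure \<mu> (map_prod (boundary_translate G g) (boundary_translate G g) ` A) = emeasure \<mu> A"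
    using assms(1) by (simp add: Curr_def)
  then show ?thesis
    using Cyl_in_sets[OF assms(1,3)] assms(2) unfolding Cyl_act[OF assms(2,3)] by simp
qed

end

section \<open>Edge paths\<close>

text \<open>In a tree, a path without backtracking is geodesic; the condition on the lengths records this.\<close>

definition edge_path :: "('t::real_tree \<times> 't) list \<Rightarrow> 't \<Rightarrow> 't \<Rightarrow> bool" where
  "edge_path \<gamma> x y \<longleftrightarrow> \<gamma> \<noteq> [] \<and> set \<gamma> \<subseteq> tree_edges \<and>
     successively (\<lambda>e e'. snd e = fst e' \<and> fst e \<noteq> snd e') \<gamma> \<and>
     fst (hd \<gamma>) = x \<and> snd (last \<gamma>) = y \<and>
     sum_list (map (\<lambda>e. dist (fst e) (snd e)) \<gamma>) = dist x y"

text \<open>Cut the segment at an interior vertex, if there is one; both halves contain fewer vertices. The paths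
  stay in their halves, so there is no backtracking where they meet.\<close>

lemma ex_edge_path:
  fixes x y :: "'t::real_tree"
  assumes "finite {w \<in> seg x y. tree_vertex w}" "x \<noteq> y" "tree_vertex x" "tree_vertex y"
  shows "\<exists>\<gamma>. edge_path \<gamma> x y \<and> (\<forall>e\<in>set \<gamma>. fst e \<in> seg x y \<and> snd e \<in> seg x y)"
  using assms
proof (induction "card {w \<in> seg x y. tree_vertex w}" arbitrary: x y rule: less_induct)
  case less
  let ?V = "\<lambda>x y. {w \<in> seg x y. tree_vertex w}"
  show ?case
  proof (cases "(x, y) \<in> tree_edges")
    case True
    then show ?thesis
      by (intro exI[of _ "[(x, y)]"]) (auto simp: edge_path_def mem_seg_endpoints)
  next
    case False
    then obtain z where z: "z \<in> seg x y" "tree_vertex z" "z \<noteq> x" "z \<noteq> y"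
      using less.prems(2-4) by (auto simp: tree_edges_def)
    have dz: "dist x z + dist z y = dist x y" using z(1) by (simp add: mem_seg_iff)
    have sub: "?V x z \<subseteq> ?V x y" "?V z y \<subseteq> ?V x y" using sub_seg[OF z(1)] by auto
    have "0 < dist x z" "0 < dist z y" using z(3,4) by auto
    then have "y \<notin> seg x z" "x \<notin> seg z y"
      using dz dist_commute[of y z] dist_commute[of z x] unfolding mem_seg_iff by linarith+
    then have "?V x z \<subset> ?V x y" "?V z y \<subset> ?V x y"
      using sub less.prems(3,4) mem_seg_endpoints by blast+
    then have c: "card (?V x z) < card (?V x y)" "card (?V z y) < card (?V x y)"
      using less.prems(1) psubset_card_mono by blast+
    have fin: "finite (?V x z)" "finite (?V z y)" using sub less.prems(1) finite_subset by blast+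
    obtain \<gamma>1 where 1: "edge_path \<gamma>1 x z" "\<forall>e\<in>set \<gamma>1. fst e \<in> seg x z \<and> snd e \<in> seg x z"
      using less.hyps[OF c(1) fin(1) z(3)[symmetric] less.prems(3) z(2)] by blast
    obtain \<gamma>2 where 2: "edge_path \<gamma>2 z y" "\<forall>e\<in>set \<gamma>2. fst e \<in> seg z y \<and> snd e \<in> seg z y"
      using less.hyps[OF c(2) fin(2) z(4) z(2) less.prems(4)] by blast
    have ne: "\<gamma>1 \<noteq> []" "\<gamma>2 \<noteq> []" using 1 2 by (auto simp: edge_path_def)
    have junction: "fst (last \<gamma>1) \<noteq> snd (hd \<gamma>2)"
    proof
      assume eq: "fst (last \<gamma>1) = snd (hd \<gamma>2)"
      let ?a = "fst (last \<gamma>1)"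
      have a: "?a \<in> seg x z" using 1(2) last_in_set[OF ne(1)] by blast
      have a': "?a \<in> seg z y" unfolding eq using 2(2) hd_in_set[OF ne(2)] by blast
      have "dist x y \<le> dist x ?a + dist ?a y" by (rule dist_triangle)
      then have "dist ?a z \<le> 0" using a a' dz dist_commute[of z ?a] unfolding mem_seg_iff by linarith
      then have "?a = z" by simp
      moreover have "last \<gamma>1 \<in> tree_edges" using 1(1) ne by (auto simp: edge_path_def)
      moreover have "snd (last \<gamma>1) = z" using 1(1) by (simp add: edge_path_def)
      ultimately show False by (auto simp: tree_edges_def)
    qed
    have "edge_path (\<gamma>1 @ \<gamma>2) x y"
      using 1(1) 2(1) ne junction dz by (auto simp: edge_path_def successively_append_iff)
    moreover have "\<forall>e\<in>set (\<gamma>1 @ \<gamma>2). fst e \<in> seg x y \<and> snd e \<in> seg x y"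
      using 1(2) 2(2) sub_seg[OF z(1)] by auto
    ultimately show ?thesis by blast
  qed
qed

context tree_action
begin

abbreviation edge_orb :: "'t \<times> 't \<Rightarrow> ('t \<times> 't) set" where
  "edge_orb \<equiv> edge_orbit G act"

abbreviation edge_act :: "'a \<Rightarrow> 't \<times> 't \<Rightarrow> 't \<times> 't" where
  "edge_act g \<equiv> map_prod (act g) (act g)"

lemma mem_edge_orb_iff: "f \<in> edge_orb e \<longleftrightarrow> (\<exists>g\<in>carrier G. f = edge_act g e)"
  by (auto simp: edge_orbit_def orbit_def)

lemma self_mem_edge_orb: "e \<in> edge_orb e"
  unfolding mem_edge_orb_iff by (intro bexI[of _ \<one>]) (auto simp: prod_eq_iff)

lemma edge_length_edge_orb: "edge_length (edge_orb e) = dist (fst e) (snd e)"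
  unfolding edge_length_def
proof (rule the_equality)
  show "\<forall>(x, y)\<in>edge_orb e. dist x y = dist (fst e) (snd e)"
    by (cases e) (auto simp: mem_edge_orb_iff)
  show "l = dist (fst e) (snd e)" if "\<forall>(x, y)\<in>edge_orb e. dist x y = l" for l
    using that self_mem_edge_orb[of e] by (cases e) auto
qed

lemma endpoint_images: 
  assumes "snd e = fst f"
  shows "snd ` edge_orb e = fst ` edge_orb f"
proof -
  have "snd ` edge_orb e = {act g (snd e) | g. g \<in> carrier G}" for e
    by (force simp: edge_orbit_def orbit_def image_iff)
  moreover have "fst ` edge_orb e = {act g (fst e) | g. g \<in> carrier G}" for e
    by (force simp: edge_orbit_def orbit_def image_iff)
  ultimately show ?thesis using assms by simp
qed

text \<open>If the orbit of an edge were the reverse of the orbit of the preceding one, the element that maps one to the other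
  would fix their common vertex; by freeness it is the identity, and the path backtracks.\<close>

lemma edge_orb_not_converse:
  assumes "snd e = fst f" "fst e \<noteq> snd f"
  shows "edge_orb f \<noteq> (edge_orb e)\<inverse>"
proof
  assume "edge_orb f = (edge_orb e)\<inverse>"
  then have "(snd f, fst f) \<in> edge_orb e" using self_mem_edge_orb[of f] by (cases f) auto
  then obtain g where g: "g \<in> carrier G" "snd f = act g (fst e)" "fst f = act g (snd e)"
    unfolding mem_edge_orb_iff by (cases e) auto
  then have "g = \<one>" using act_free assms(1) by metis
  then show False using g(2) assms(2) by simp
qed

lemma edge_path_reduced:
  assumes "edge_path \<gamma> x y"
  shows "map edge_orb \<gamma> \<in> reduced_paths G act"
proof -
  have "successively (\<lambda>e e'. snd ` edge_orb e = fst ` edge_orb e' \<and> edge_orb e' \<noteq> (edge_orb e)\<inverse>) \<gamma>"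
    using assms unfolding edge_path_def
    by (elim conjE successively_mono) (simp add: endpoint_images edge_orb_not_converse)
  then show ?thesis
    using assms by (auto simp: reduced_paths_def edge_path_def graph_edges_def successively_map)
qed

lemma path_length_edge_path: "edge_path \<gamma> x y \<Longrightarrow> path_length (map edge_orb \<gamma>) = dist x y"
  by (simp add: path_length_def edge_path_def edge_length_edge_orb o_def)

lemma edge_path_is_lift: "edge_path \<gamma> x y \<Longrightarrow> is_lift G act (map edge_orb \<gamma>) \<gamma>"
  unfolding is_lift_def edge_path_def by (auto elim: successively_mono)

text \<open>The elements that move the individual edges of one lift to those of the other agree on the common
  vertices, hence coincide, because the action is free.\<close>

lemma lift_unique_of_first_edge:
  assumes "successively (\<lambda>e e'. snd e = fst e') (e # r)" "successively (\<lambda>e e'. snd e = fst e') (e' # r')"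
    "map edge_orb (e # r) = map edge_orb (e' # r')" "g \<in> carrier G" "e' = edge_act g e"
  shows "e' # r' = map (edge_act g) (e # r)"
  using assms
proof (induction r arbitrary: e e' r')
  case Nil
  then show ?case by simp
next
  case (Cons f r)
  then obtain f' s where r': "r' = f' # s" by (cases r') auto
  have "f' \<in> edge_orb f" using Cons.prems(3) self_mem_edge_orb[of f'] by (simp add: r')
  then obtain h where h: "h \<in> carrier G" "f' = edge_act h f" unfolding mem_edge_orb_iff by blast
  have "act h (fst f) = act g (fst f)"
    using Cons.prems(1,2,5) h(2) by (cases e; cases f) (simp add: r')
  then have "h = g" using act_inj h(1) Cons.prems(4) by blast
  then have "f' # s = map (edge_act g) (f # r)"
    using Cons.IH[of f f' s] Cons.prems h by (simp add: r')
  then show ?case using Cons.prems(5) by (simp add: r')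
qed

lemma lift_unique_up_to_translation:
  assumes "is_lift G act v \<gamma>" "is_lift G act v \<gamma>'" "\<gamma> \<noteq> []"
  shows "\<exists>g\<in>carrier G. \<gamma>' = map (edge_act g) \<gamma>"
proof -
  have m: "map edge_orb \<gamma> = map edge_orb \<gamma>'" using assms(1,2) by (simp add: is_lift_def)
  then have "\<gamma>' \<noteq> []" using assms(3) by auto
  then obtain e r e' r' where er: "\<gamma> = e # r" "\<gamma>' = e' # r'" using assms(3) by (meson neq_Nil_conv)
  have "e' \<in> edge_orb e" using m self_mem_edge_orb[of e'] by (simp add: er)
  then obtain g where "g \<in> carrier G" "e' = edge_act g e" unfolding mem_edge_orb_iff by blast
  then show ?thesis
    using lift_unique_of_first_edge[of e r e' r' g] assms(1,2) m by (auto simp: er is_lift_def)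
qed

lemma path_measure_edge_path:
  assumes "\<mu> \<in> Curr G X" "edge_path \<gamma> x y" "x \<noteq> y"
  shows "path_measure G X act \<mu> (map edge_orb \<gamma>) = emeasure \<mu> (Cyl G X act x y)"
proof -
  define \<gamma>' where "\<gamma>' = (SOME \<gamma>'. is_lift G act (map edge_orb \<gamma>) \<gamma>')"
  have ne: "\<gamma> \<noteq> []" and ends: "fst (hd \<gamma>) = x" "snd (last \<gamma>) = y" using assms(2) by (auto simp: edge_path_def)
  have l: "is_lift G act (map edge_orb \<gamma>) \<gamma>" using edge_path_is_lift assms(2) by blast
  then have "is_lift G act (map edge_orb \<gamma>) \<gamma>'" unfolding \<gamma>'_def by (rule someI)
  then obtain g where g: "g \<in> carrier G" "\<gamma>' = map (edge_act g) \<gamma>" using lift_unique_up_to_translation[OF l _ ne] by blast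
  then have "fst (hd \<gamma>') = act g x" "snd (last \<gamma>') = act g y"
    using ne ends by (simp_all add: hd_map last_map)
  then show ?thesis
    using emeasure_Cyl_act[OF assms(1) g(1) assms(3)] by (simp add: path_measure_def \<gamma>'_def[symmetric])
qed

text \<open>The translation that relates two lifts fixes their common initial vertex, hence is trivial.\<close>

lemma edge_path_endpoint_eq:
  assumes "edge_path \<gamma> x y" "edge_path \<gamma>' x y'" "map edge_orb \<gamma> = map edge_orb \<gamma>'"
  shows "y = y'"
proof -
  have ne: "\<gamma> \<noteq> []" using assms(1) by (simp add: edge_path_def)
  have "is_lift G act (map edge_orb \<gamma>) \<gamma>'"
    using edge_path_is_lift[OF assms(2)] assms(3) by simp
  then obtain g where g: "g \<in> carrier G" "\<gamma>' = map (edge_act g) \<gamma>"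
    using lift_unique_up_to_translation[OF edge_path_is_lift[OF assms(1)] _ ne] by blast
  have "act g x = x" using assms(1,2) g ne by (auto simp: edge_path_def hd_map)
  then have "g = \<one>" using act_free g(1) by blast
  then show ?thesis using assms(1,2) g ne by (auto simp: edge_path_def last_map)
qed

section \<open>Counting\<close>

text \<open>Every geodesic line passes two vertices, so countably many cylinders cover the whole space.\<close>

lemma ex_positive_cylinder:
  assumes \<mu>: "\<mu> \<in> Curr G X" "emeasure \<mu> (space \<mu>) \<noteq> 0"
  shows "\<exists>x y. tree_vertex x \<and> x \<noteq> y \<and> emeasure \<mu> (Cyl G X act x y) \<noteq> 0"
proof (rule ccontr)
  assume "\<not> ?thesis"
  then have zero: "emeasure \<mu> (Cyl G X act x y) = 0" if "tree_vertex x" "x \<noteq> y" for x y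
    using that by blast
  obtain D where D: "\<And>x::'t. \<exists>v. tree_vertex v \<and> dist x v \<le> D" using vertices_cobounded by blast
  let ?I = "{(x :: 't, y :: 't). tree_vertex x \<and> tree_vertex y \<and> x \<noteq> y}"
  have "countable ?I"
    by (rule countable_subset[OF _ countable_SIGMA[OF countable_vertices countable_vertices]]) auto
  then have null: "(\<Union>xy\<in>?I. Cyl G X act (fst xy) (snd xy)) \<in> null_sets \<mu>"
    using zero Cyl_in_sets[OF \<mu>(1)] by (intro null_sets_UN') auto
  have "space \<mu> \<subseteq> (\<Union>xy\<in>?I. Cyl G X act (fst xy) (snd xy))"
  proof
    fix \<zeta> assume "\<zeta> \<in> space \<mu>"
    then obtain \<zeta>1 \<zeta>2 where z: "\<zeta> = (\<zeta>1, \<zeta>2)" "(\<zeta>1, \<zeta>2) \<in> topspace (free_boundary2 G X)"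
      using \<mu>(1) by (cases \<zeta>) (auto simp: Curr_def)
    obtain c where c: "geodesic_line c" "(\<lambda>n. c (- real n)) \<in> orbit_boundary_map act \<zeta>1"
      "(\<lambda>n. c (real n)) \<in> orbit_boundary_map act \<zeta>2" by (rule ex_line_between_ends[OF z(2)])
    obtain s where s: "0 \<le> s" "s \<le> 0 + 2 * D" "tree_vertex (c s)" by (rule vertex_near_line[OF c(1) D])
    obtain t where t: "2 * D + 1 \<le> t" "t \<le> 2 * D + 1 + 2 * D" "tree_vertex (c t)"
      by (rule vertex_near_line[OF c(1) D])
    have "s < t" using s t by simp
    moreover have "dist (c s) (c t) = \<bar>s - t\<bar>" using c(1) by (simp add: geodesic_line_def)
    ultimately have "(c s, c t) \<in> ?I" using s t by auto
    moreover have "\<zeta> \<in> Cyl G X act (c s) (c t)" using CylI[OF z(2) c \<open>s < t\<close>] z(1) by simp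
    ultimately show "\<zeta> \<in> (\<Union>xy\<in>?I. Cyl G X act (fst xy) (snd xy))" by force
  qed
  from emeasure_mono[OF this null_setsD2[OF null]] show False
    using null_setsD1[OF null] \<mu>(2) by simp
qed

text \<open>Follow the line beyond \<open>x\<close>: it meets a vertex in the window of length \<open>2 * D\<close> that begins at distance \<open>R\<close>.\<close>

lemma Cyl_subset_UN_Cyl:
  assumes D: "\<And>x::'t. \<exists>v. tree_vertex v \<and> dist x v \<le> D" and "0 < R"
  shows "Cyl G X act x y \<subseteq>
    (\<Union>z\<in>{z. tree_vertex z \<and> R \<le> dist x z \<and> dist x z \<le> R + 2 * D}. Cyl G X act x z)"
proof
  fix \<zeta> assume "\<zeta> \<in> Cyl G X act x y"
  then obtain \<zeta>1 \<zeta>2 c s where z: "\<zeta> = (\<zeta>1, \<zeta>2)" "(\<zeta>1, \<zeta>2) \<in> topspace (free_boundary2 G X)"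
    and c: "geodesic_line c" "(\<lambda>n. c (- real n)) \<in> orbit_boundary_map act \<zeta>1"
      "(\<lambda>n. c (real n)) \<in> orbit_boundary_map act \<zeta>2" and s: "c s = x"
    unfolding Cyl_def by blast
  obtain t where t: "s + R \<le> t" "t \<le> s + R + 2 * D" "tree_vertex (c t)"
    by (rule vertex_near_line[OF c(1) D])
  have "s < t" using t \<open>0 < R\<close> by simp
  have "dist x (c t) = t - s" using c(1) s \<open>s < t\<close> by (auto simp: geodesic_line_def)
  moreover have "\<zeta> \<in> Cyl G X act x (c t)" using CylI[OF z(2) c \<open>s < t\<close>] z(1) s by simp
  ultimately show "\<zeta> \<in> (\<Union>z\<in>{z. tree_vertex z \<and> R \<le> dist x z \<and> dist x z \<le> R + 2 * D}. Cyl G X act x z)"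
    using t by (intro UN_I[of "c t"]) auto
qed

text \<open>Subadditivity over the covering by cylinders of vertices at distance about \<open>R\<close>, where the ones of mass zero drop
  out and the others inject into the paths counted by \<open>supp_count\<close>. If there are infinitely many of the latter, the
  bound is infinite.\<close>

lemma emeasure_Cyl_le_supp_count:
  fixes x y :: 't
  assumes \<mu>: "\<mu> \<in> Curr G X" and x: "tree_vertex x" and xy: "x \<noteq> y"
    and D: "\<And>x::'t. \<exists>v. tree_vertex v \<and> dist x v \<le> D" and R: "0 < R" 
    and b: "0 < b" "\<And>z. R \<le> dist x z \<Longrightarrow> dist x z \<le> R + 2 * D \<Longrightarrow> emeasure \<mu> (Cyl G X act x z) \<le> b"
  shows "emeasure \<mu> (Cyl G X act x y) \<le> supp_count G X act \<mu> (R + 2 * D) * b"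
proof -
  let ?C = "Cyl G X act x"
  define Z where "Z = {z. tree_vertex z \<and> R \<le> dist x z \<and> dist x z \<le> R + 2 * D}"
  define P where "P = {z \<in> Z. emeasure \<mu> (?C z) > 0}"
  have ne: "x \<noteq> z" if "z \<in> Z" for z using that R by (auto simp: Z_def)
  have meas: "?C z \<in> sets \<mu>" if "z \<in> Z" for z using Cyl_in_sets[OF \<mu> ne[OF that]] .
  have countZ: "countable Z" using countable_vertices by (rule countable_subset[rotated]) (auto simp: Z_def)
  have "\<exists>\<gamma>. edge_path \<gamma> x z" if "z \<in> Z" for z
    using ex_edge_path[OF finite_vertices_seg ne[OF that] x] that by (auto simp: Z_def)
  then obtain \<gamma> where \<gamma>: "\<And>z. z \<in> Z \<Longrightarrow> edge_path (\<gamma> z) x z" by metis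
  define v where "v z = map edge_orb (\<gamma> z)" for z
  have inj: "inj_on v P"
    unfolding inj_on_def v_def P_def using edge_path_endpoint_eq[OF \<gamma> \<gamma>] by blast
  have into: "v ` P \<subseteq> {v \<in> supp G X act \<mu>. path_length v \<le> R + 2 * D}"
    using \<gamma> edge_path_reduced path_measure_edge_path[OF \<mu> \<gamma> ne] path_length_edge_path[OF \<gamma>]
    by (auto simp: supp_def v_def P_def) (auto simp: Z_def)
  have le: "emeasure (count_space UNIV) (v ` P) \<le> supp_count G X act \<mu> (R + 2 * D)"
    unfolding supp_count_def using into by (intro emeasure_mono) auto
  show ?thesis
  proof (cases "finite P")
    case False
    then have "infinite (v ` P)" using inj finite_image_iff by blast
    then have "supp_count G X act \<mu> (R + 2 * D) = \<infinity>" using le by (simp add: emeasure_count_space_infinite top.extremum_unique)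
    then show ?thesis using b(1) by (simp add: ennreal_top_mult)
  next
    case True
    have PZ: "P \<subseteq> Z" by (auto simp: P_def)
    have sets: "(\<Union>z\<in>P. ?C z) \<in> sets \<mu>" "(\<Union>z\<in>Z - P. ?C z) \<in> sets \<mu>"
      using countZ PZ meas by (auto intro!: sets.countable_UN' intro: countable_subset)
    have "?C y \<subseteq> (\<Union>z\<in>P. ?C z) \<union> (\<Union>z\<in>Z - P. ?C z)"
      using Cyl_subset_UN_Cyl[OF D R, of x y] PZ unfolding Z_def[symmetric] by blast
    then have "emeasure \<mu> (?C y) \<le> emeasure \<mu> ((\<Union>z\<in>P. ?C z) \<union> (\<Union>z\<in>Z - P. ?C z))"
      using sets by (intro emeasure_mono) auto
    also have "\<dots> \<le> emeasure \<mu> (\<Union>z\<in>P. ?C z) + emeasure \<mu> (\<Union>z\<in>Z - P. ?C z)"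
      using sets by (rule emeasure_subadditive)
    also have "(\<Union>z\<in>Z - P. ?C z) \<in> null_sets \<mu>"
      using countZ meas by (intro null_sets_UN') (auto simp: P_def)
    then have "emeasure \<mu> (\<Union>z\<in>Z - P. ?C z) = 0" by blast
    also have "emeasure \<mu> (\<Union>z\<in>P. ?C z) + 0 \<le> (\<Sum>z\<in>P. emeasure \<mu> (?C z))"
      using emeasure_subadditive_finite[OF True, of ?C \<mu>] meas by (auto simp: P_def)
    also have "\<dots> \<le> (\<Sum>z\<in>P. b)" using b(2) by (intro sum_mono) (auto simp: P_def Z_def)
    also have "\<dots> = of_nat (card (v ` P)) * b" using inj by (simp add: card_image)
    also have "of_nat (card (v ` P)) = emeasure (count_space UNIV) (v ` P)"
      using True by (simp add: emeasure_count_space_finite)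
    also have "emeasure (count_space UNIV) (v ` P) * b \<le> supp_count G X act \<mu> (R + 2 * D) * b"
      using le by (rule mult_right_mono) simp
    finally show ?thesis .
  qed
qed

end

lemma elog_ge:
  assumes "0 < r" "ennreal r \<le> a"
  shows "ereal (ln r) \<le> elog a"
proof (cases "a = \<infinity>")
  case False
  then obtain s where s: "a = ennreal s" "0 \<le> s" by (cases a) auto
  then have "r \<le> s" using assms by (simp add: ennreal_le_iff)
  then show ?thesis using assms(1) s by (simp add: elog_def)
qed (simp add: elog_def)

lemma le_exp_of_less_elog:
  assumes "ereal h < - elog a / ereal d" "0 < d"
  shows "a \<le> ennreal (exp (- h * d))"
proof -
  consider "a = 0" | "a = \<infinity>" | s where "a = ennreal s" "0 < s"
    by (cases a) (auto simp: less_le)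
  then show ?thesis
  proof cases
    case 2
    then have "- elog a / ereal d = - \<infinity>" using assms(2) by (simp add: elog_def)
    then show ?thesis using assms(1) by simp
  next
    case 3
    then have "h < - ln s / d" using assms by (simp add: elog_def)
    then have "ln s < - h * d" using assms(2) by (simp add: field_simps)
    then have "s < exp (- h * d)" using 3 by (metis exp_less_cancel_iff exp_ln)
    then show ?thesis using 3 by (simp add: ennreal_leI)
  qed simp
qed

lemma (in tree_action) le_supp_growth:
  fixes h N D m :: real and x y :: 't
  assumes \<mu>: "\<mu> \<in> Curr G X" and x: "tree_vertex x" and xy: "x \<noteq> y"
    and D: "\<And>x::'t. \<exists>v. tree_vertex v \<and> dist x v \<le> D"
    and m: "0 < m" "ennreal m \<le> emeasure \<mu> (Cyl G X act x y)"
    and decay: "\<And>a b :: 't. N \<le> dist a b \<Longrightarrow> emeasure \<mu> (Cyl G X act a b) \<le> ennreal (exp (- h * dist a b))"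
  shows "ereal h \<le> supp_growth G X act \<mu>"
proof -
  define c where "c = ln m - 2 * D * \<bar>h\<bar> - 2 * D * h"
  have D0: "0 \<le> D" using D[of x] zero_le_dist order_trans by blast
  have count: "ereal (h + c / R) \<le> elog (supp_count G X act \<mu> R) / ereal R"
    if R: "\<bar>N\<bar> + 2 * D + 1 \<le> R" for R
  proof -
    let ?S = "supp_count G X act \<mu> R"
    define r where "r = R - 2 * D"
    have r: "0 < r" "N \<le> r" "0 < R" using R D0 by (auto simp: r_def)
    define b where "b = exp (2 * D * \<bar>h\<bar> - h * r)"
    have "emeasure \<mu> (Cyl G X act x z) \<le> ennreal b" if z: "r \<le> dist x z" "dist x z \<le> r + 2 * D" for z
    proof -
      have "- h * (dist x z - r) \<le> \<bar>- h\<bar> * (dist x z - r)"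
        by (rule mult_right_mono) (use z in auto)
      also have "\<dots> \<le> \<bar>h\<bar> * (2 * D)" using z by (simp add: mult_left_mono)
      finally have "- h * dist x z \<le> 2 * D * \<bar>h\<bar> - h * r" by (simp add: algebra_simps)
      then have "ennreal (exp (- h * dist x z)) \<le> ennreal b" unfolding b_def by (intro ennreal_leI) simp
      then show ?thesis using decay[of x z] z(1) r(2) by simp
    qed
    then have "emeasure \<mu> (Cyl G X act x y) \<le> ?S * ennreal b"
      using emeasure_Cyl_le_supp_count[OF \<mu> x xy D r(1), of "ennreal b"] by (simp add: b_def r_def)
    then have le: "ennreal m \<le> ?S * ennreal b" using m(2) by (rule order_trans[rotated])
    have "ennreal (m / b) \<le> ?S"
    proof (cases "?S = \<infinity>")
      case False
      then obtain s where s: "?S = ennreal s" "0 \<le> s" by (cases ?S) auto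
      have "ennreal m \<le> ennreal (s * b)" using le s by (simp add: ennreal_mult b_def)
      then have "m \<le> s * b" using s by (simp add: b_def)
      then show ?thesis using s by (simp add: b_def field_simps ennreal_leI)
    qed simp
    then have "ereal (ln (m / b)) \<le> elog ?S" using m(1) by (intro elog_ge) (auto simp: b_def)
    moreover have "ln (m / b) = R * (h + c / R)"
      using m(1) r(3) by (simp add: ln_div b_def c_def r_def field_simps)
    ultimately have "ereal (R * (h + c / R)) \<le> elog ?S" by simp
    then show ?thesis using r(3) by (simp add: ereal_le_divide_pos)
  qed
  have "((\<lambda>R. h + c / R) \<longlongrightarrow> h + 0) at_top"
    by (intro tendsto_add tendsto_const tendsto_divide_0[OF tendsto_const]
        filterlim_at_top_imp_at_infinity filterlim_ident)
  then have "((\<lambda>R. ereal (h + c / R)) \<longlongrightarrow> ereal h) at_top" by simp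
  then have "Liminf at_top (\<lambda>R. ereal (h + c / R)) = ereal h"
    by (intro lim_imp_Liminf) auto
  moreover have "\<forall>\<^sub>F R in at_top. ereal (h + c / R) \<le> elog (supp_count G X act \<mu> R) / ereal R"
    using count by (auto simp: eventually_at_top_linorder)
  ultimately show ?thesis unfolding supp_growth_def by (metis Liminf_mono)
qed

theorem theorem3p9:
  fixes G :: "('g, 'b) monoid_scheme"
    and X :: "'g set"
    and k :: nat
    and act :: "'g \<Rightarrow> 't::real_tree \<Rightarrow> 't"
    and \<mu> :: "((nat \<Rightarrow> 'g) set \<times> (nat \<Rightarrow> 'g) set) measure"
  assumes "free_basis G X" "finite X" "card X = k" "k \<ge> 2"
    and "cv G act"
    and "\<mu> \<in> Curr G X" "emeasure \<mu> (space \<mu>) \<noteq> 0"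
  shows "geometric_entropy G X act \<mu> \<le> supp_growth G X act \<mu>"
proof (rule dense_le)
  \<comment> \<open>The base point is arbitrary.\<close>
  interpret tree_action G X act undefined
    by unfold_locales (use assms in auto)
  fix e assume e: "e < geometric_entropy G X act \<mu>"
  show "e \<le> supp_growth G X act \<mu>"
  proof (cases e)
    case (real h)
    obtain x y where xy: "tree_vertex x" "x \<noteq> y" "emeasure \<mu> (Cyl G X act x y) \<noteq> 0"
      using ex_positive_cylinder[OF assms(6,7)] by blast
    obtain D where D: "\<And>x::'t. \<exists>v. tree_vertex v \<and> dist x v \<le> D" using vertices_cobounded by blast
    obtain m where m: "0 < m" "ennreal m \<le> emeasure \<mu> (Cyl G X act x y)"
    proof (cases "emeasure \<mu> (Cyl G X act x y)")
      case (real r)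
      then show ?thesis using that[of r] xy(3) by (simp add: less_le)
    next
      case top
      then show ?thesis using that[of 1] by simp
    qed
    have "\<forall>\<^sub>F (a, b) in filtercomap (\<lambda>(x, y). dist x y) at_top.
        ereal h < - elog (emeasure \<mu> (Cyl G X act a b)) / ereal (dist a b)"
      using less_LiminfD[OF e[unfolded geometric_entropy_def]] real by (simp add: case_prod_unfold)
    then obtain N where N: "\<And>a b. N \<le> dist a b \<Longrightarrow>
        ereal h < - elog (emeasure \<mu> (Cyl G X act a b)) / ereal (dist a b)"
      unfolding eventually_filtercomap_at_top_linorder by auto
    have decay: "emeasure \<mu> (Cyl G X act a b) \<le> ennreal (exp (- h * dist a b))" if "max N 1 \<le> dist a b" for a b
    proof (rule le_exp_of_less_elog)
      show "0 < dist a b" using that by linarith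
      show "ereal h < - elog (emeasure \<mu> (Cyl G X act a b)) / ereal (dist a b)" using N that by simp
    qed
    have "ereal h \<le> supp_growth G X act \<mu>" by (rule le_supp_growth[OF assms(6) xy(1,2) D m decay])
    then show ?thesis using real by simp
  qed (use e in auto)
qed

end
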